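(* Let $0<s_{\min}<s_{\max}$, $L>0$, $\tau>2$, and assume $m\le n^{1/(1+2s_{\max})}$ (where $m=m_n$ may depend on $n$). Let $\widetilde\Pi(\cdot\,|\,Y^{(1:m)})$ be the distributed empirical Bayes (aggregated) posterior on functions $f=\sum_{i\ge0}\sum_{j=0}^{2^i-1}\widetilde\theta_{ij}\psi_{ij}$ under which, given the data $Y^{(1:m)}$, the coefficients are independent with $$\widetilde\theta_{ij}\,\big|\,Y^{(1:m)}\sim \begin{cases}\mathcal N\Big(\dfrac{n}{m(n+1)}\displaystyle\sum_{k=1}^m y_{ij}^{(k)},\ \dfrac1{n+1}\Big), & 0\le i\le\hat\ell,\\[2mm] \delta_0, & i>\hat\ell,\end{cases}\qquad j=0,\dots,2^i-1,$$ where $\hat\ell$ is the data-driven truncation level defined in the context. Then for every $s\in(s_{\min},s_{\max})$ and every sequence $M_n\to\infty$, $$\sup_{f_0\in B^s_{2,\infty}(L)}E_{f_0}\,\widetilde\Pi\Big(f:\ \|f-f_0\|_2^2\ge M_n\,n^{-2s/(1+2s)}\ \Big|\ Y^{(1:m)}\Big)\longrightarrow 0\qquad\text{as } n\to\infty.$$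
   Context: Model. Let $\{\psi_{ij}: i\ge 0,\ j=0,\dots,2^i-1\}$ be a fixed orthonormal (boundary-corrected Cohen–Daubechies–Vial) wavelet basis of $L^2[0,1]$, and write $f_0=\sum_{i\ge0}\sum_{j=0}^{2^i-1}\theta_{0,ij}\psi_{ij}$; $\|\cdot\|_2$ is the $L^2[0,1]$ norm. In the distributed signal-in-white-noise model with $m$ machines and total sample size (signal-to-noise parameter) $n$, machine $k\in\{1,\dots,m\}$ observes $Y^{(k)}=(y_{ij}^{(k)})$, $$y_{ij}^{(k)}=\theta_{0,ij}+\sqrt{\tfrac mn}\,Z_{ij}^{(k)},\qquad i\ge0,\ j=0,\dots,2^i-1,$$ with $Z_{ij}^{(k)}$ i.i.d. $N(0,1)$ over all $i,j,k$. $Y^{(1:m)}=(Y^{(1)},\dots,Y^{(m)})$ is the full data; $E_{f_0}$ denotes expectation under this model. $\delta_0$ is the point mass at $0$. Besov ball. $f_0\in B^s_{2,\infty}(L)$ means that its coefficient sequence $\theta_0$ is in $\ell_2$ and $\sup_{i\ge0}2^{2is}\sum_{j=0}^{2^i-1}\theta_{0,ij}^2\le L$. Truncation level. Put $T_i^{(k)}=2^{-i}\sum_{j=0}^{2^i-1}(y_{ij}^{(k)})^2$, $T_i=\frac1m\sum_{k=1}^mT_i^{(k)}$ and $\widetilde T_i=2^iT_i-2^i m/n$. Let $\mathcal L$ be the set of integers in $\big[\frac{\log_2 n}{1+2s_{\max}},\frac{\log_2 n}{1+2s_{\min}}\big]$. Define $$\hat\ell=\min\Big\{\ell\in\mathcal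 L:\ \sum_{i=\ell}^{l}\widetilde T_i\le \tau 2^l/n\ \text{ for all } l\in\mathcal L,\ l\ge\ell\Big\},$$ with $\hat\ell=\lfloor\log_2(n)/(1+2s_{\min})\rfloor$ if this set is empty. *)

theory Defs
  imports "HOL-Probability.Probability"
begin

section \<open>The space $L^2[0,1]$ and orthonormal bases indexed by resolution level\<close>

definition L2_01 :: "(real \<Rightarrow> real) set" where
  "L2_01 = {f \<in> borel_measurable (lebesgue_on {0..1}).
              integrable (lebesgue_on {0..1}) (\<lambda>x. (f x)\<^sup>2)}"

definition inner_01 :: "(real \<Rightarrow> real) \<Rightarrow> (real \<Rightarrow> real) \<Rightarrow> real" where
  "inner_01 f g = (LINT x|lebesgue_on {0..1}. f x * g x)"

definition norm_01 :: "(real \<Rightarrow> real) \<Rightarrow> real" where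
  "norm_01 f = sqrt (LINT x|lebesgue_on {0..1}. (f x)\<^sup>2)"

definition wav_index :: "(nat \<times> nat) set" where
  "wav_index = {(i, j). j < 2 ^ i}"

text \<open>
  The only structure of the wavelet system that enters the model, the Besov ball, the prior and the
  loss is that it is an orthonormal basis of $L^2[0,1]$ indexed by levels \<open>i\<close> and positions
  \<open>j < 2 ^ i\<close>; boundary-corrected Cohen-Daubechies-Vial wavelets are an instance.
\<close>

definition orthonormal_basis_01 :: "(nat \<Rightarrow> nat \<Rightarrow> real \<Rightarrow> real) \<Rightarrow> bool" where
  "orthonormal_basis_01 \<psi> \<longleftrightarrow>
     (\<forall>(i, j) \<in> wav_index. \<psi> i j \<in> L2_01) \<and>
     (\<forall>(i, j) \<in> wav_index. \<forall>(i', j') \<in> wav_index.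
        inner_01 (\<psi> i j) (\<psi> i' j') = (if i = i' \<and> j = j' then 1 else 0)) \<and>
     (\<forall>f \<in> L2_01.
        (\<lambda>N. norm_01 (\<lambda>x. f x - (\<Sum>i<N. \<Sum>j<2 ^ i. inner_01 f (\<psi> i j) * \<psi> i j x))) \<longlonglongrightarrow> 0)"

definition besov_ball :: "(nat \<Rightarrow> nat \<Rightarrow> real \<Rightarrow> real) \<Rightarrow> real \<Rightarrow> real \<Rightarrow> (real \<Rightarrow> real) set" where
  "besov_ball \<psi> s L = {f \<in> L2_01.
     (\<lambda>(i, j). (inner_01 f (\<psi> i j))\<^sup>2) summable_on wav_index \<and>
     (\<forall>i. 2 powr (2 * real i * s) * (\<Sum>j<2 ^ i. (inner_01 f (\<psi> i j))\<^sup>2) \<le> L)}"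

section \<open>The distributed signal-in-white-noise model\<close>

text \<open>A data set is a function \<open>y\<close> with \<open>y k i j\<close> the observation of machine \<open>k \<in> {1..m}\<close>.\<close>

definition noise_law :: "nat \<Rightarrow> (nat \<times> nat \<times> nat \<Rightarrow> real) measure" where
  "noise_law m = (\<Pi>\<^sub>M (k, i, j) \<in> {1..m} \<times> wav_index. density lborel std_normal_density)"

definition observations ::
  "(nat \<Rightarrow> nat \<Rightarrow> real) \<Rightarrow> nat \<Rightarrow> nat \<Rightarrow> (nat \<times> nat \<times> nat \<Rightarrow> real) \<Rightarrow> nat \<Rightarrow> nat \<Rightarrow> nat \<Rightarrow> real" where
  "observations \<theta> n m Z k i j = \<theta> i j + sqrt (real m / real n) * Z (k, i, j)"

section \<open>The data-driven truncation level\<close>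

definition T_local :: "(nat \<Rightarrow> nat \<Rightarrow> nat \<Rightarrow> real) \<Rightarrow> nat \<Rightarrow> nat \<Rightarrow> real" where
  "T_local y k i = (\<Sum>j<2 ^ i. (y k i j)\<^sup>2) / 2 ^ i"

definition T_avg :: "nat \<Rightarrow> (nat \<Rightarrow> nat \<Rightarrow> nat \<Rightarrow> real) \<Rightarrow> nat \<Rightarrow> real" where
  "T_avg m y i = (\<Sum>k=1..m. T_local y k i) / real m"

definition T_tilde :: "nat \<Rightarrow> nat \<Rightarrow> (nat \<Rightarrow> nat \<Rightarrow> nat \<Rightarrow> real) \<Rightarrow> nat \<Rightarrow> real" where
  "T_tilde n m y i = 2 ^ i * T_avg m y i - 2 ^ i * real m / real n"

text \<open>For \<open>n \<ge> 1\<close> both end points are nonnegative, so natural numbers suffice as levels.\<close>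

definition level_grid :: "real \<Rightarrow> real \<Rightarrow> nat \<Rightarrow> nat set" where
  "level_grid s_min s_max n =
     {l. log 2 (real n) / (1 + 2 * s_max) \<le> real l \<and> real l \<le> log 2 (real n) / (1 + 2 * s_min)}"

definition admissible_levels ::
  "real \<Rightarrow> real \<Rightarrow> real \<Rightarrow> nat \<Rightarrow> nat \<Rightarrow> (nat \<Rightarrow> nat \<Rightarrow> nat \<Rightarrow> real) \<Rightarrow> nat set" where
  "admissible_levels s_min s_max \<tau> n m y =
     {l0 \<in> level_grid s_min s_max n.
        \<forall>l \<in> level_grid s_min s_max n. l0 \<le> l \<longrightarrow>
          (\<Sum>i=l0..l. T_tilde n m y i) \<le> \<tau> * 2 ^ l / real n}"

definition l_hat ::
  "real \<Rightarrow> real \<Rightarrow> real \<Rightarrow> nat \<Rightarrow> nat \<Rightarrow> (nat \<Rightarrow> nat \<Rightarrow> nat \<Rightarrow> real) \<Rightarrow> nat" where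
  "l_hat s_min s_max \<tau> n m y =
     (if admissible_levels s_min s_max \<tau> n m y = {}
      then nat \<lfloor>log 2 (real n) / (1 + 2 * s_min)\<rfloor>
      else Min (admissible_levels s_min s_max \<tau> n m y))"

section \<open>The aggregated empirical Bayes posterior\<close>

definition posterior_coeffs ::
  "real \<Rightarrow> real \<Rightarrow> real \<Rightarrow> nat \<Rightarrow> nat \<Rightarrow> (nat \<Rightarrow> nat \<Rightarrow> nat \<Rightarrow> real) \<Rightarrow> (nat \<times> nat \<Rightarrow> real) measure" where
  "posterior_coeffs s_min s_max \<tau> n m y =
     (\<Pi>\<^sub>M (i, j) \<in> wav_index.
        if i \<le> l_hat s_min s_max \<tau> n m y
        then density lborel
               (normal_density (real n / (real m * (real n + 1)) * (\<Sum>k=1..m. y k i j))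
                               (sqrt (1 / (real n + 1))))
        else return borel 0)"

text \<open>
  Under the posterior almost every coefficient sequence vanishes above the truncation level, so
  the pointwise series below is almost surely a finite sum.
\<close>

definition wavelet_series ::
  "(nat \<Rightarrow> nat \<Rightarrow> real \<Rightarrow> real) \<Rightarrow> (nat \<times> nat \<Rightarrow> real) \<Rightarrow> real \<Rightarrow> real" where
  "wavelet_series \<psi> \<theta> x = (\<Sum>i. \<Sum>j<2 ^ i. \<theta> (i, j) * \<psi> i j x)"

definition posterior_prob ::
  "(nat \<Rightarrow> nat \<Rightarrow> real \<Rightarrow> real) \<Rightarrow> real \<Rightarrow> real \<Rightarrow> real \<Rightarrow> nat \<Rightarrow> nat \<Rightarrow>
   (nat \<Rightarrow> nat \<Rightarrow> nat \<Rightarrow> real) \<Rightarrow> (real \<Rightarrow> real) set \<Rightarrow> ennreal" where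
  "posterior_prob \<psi> s_min s_max \<tau> n m y A =
     emeasure (posterior_coeffs s_min s_max \<tau> n m y)
       {\<theta> \<in> space (posterior_coeffs s_min s_max \<tau> n m y). wavelet_series \<psi> \<theta> \<in> A}"

text \<open>The expectation, under the model with true signal \<open>f0\<close>, of a nonnegative function of the data.\<close>

definition model_expectation ::
  "(nat \<Rightarrow> nat \<Rightarrow> real \<Rightarrow> real) \<Rightarrow> nat \<Rightarrow> nat \<Rightarrow> (real \<Rightarrow> real) \<Rightarrow>
   ((nat \<Rightarrow> nat \<Rightarrow> nat \<Rightarrow> real) \<Rightarrow> ennreal) \<Rightarrow> ennreal" where
  "model_expectation \<psi> n m f0 G =
     (\<integral>\<^sup>+ Z. G (observations (\<lambda>i j. inner_01 f0 (\<psi> i j)) n m Z) \<partial>noise_law m)"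

end

theory Submission
  imports Defs "HOL-Real_Asymp.Real_Asymp"
begin

text \<open>
  Let \<open>l0\<close> be the oracle level, up to constants the smallest one at which the squared bias of the Besov ball is at
  most \<open>2 ^ l0 / n\<close>; then \<open>2 ^ l0 / n\<close> is of the order of the minimax rate. The statistic \<open>T_tilde\<close>
  summed over the levels \<open>a..b\<close> is an unbiased estimate of the signal energy there, with variance at
  most \<open>4 E / n + 4 m 2 ^ b / n ^ 2\<close>. By Chebyshev and a union bound over \<open>O(log n)\<close> levels, all
  but a set of data of probability \<open>O(m log n / 2 ^ l0)\<close> has the property that \<open>l0\<close> is
  admissible, whence the selected level is at most \<open>l0\<close>, and that no
  level below \<open>l0\<close> missing more than \<open>2 \<tau> 2 ^ l0 / n\<close> of the energy is admissible. Since
  \<open>m\<close> is of smaller polynomial order than \<open>2 ^ l0\<close>, the exceptional probability vanishes. On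
  the remaining data Parseval and Markov's inequality bound the posterior mass through the posterior
  second moment of the coefficients up to level \<open>l0\<close>.

  Only upper bounds are needed, so neither the truncation level nor the posterior probability has to
  be shown measurable in the data: the upper integral is dominated by that of a measurable function.
\<close>

section \<open>Second moments of quadratic forms in the noise\<close>

text \<open>The product measure is the law of the identity, and each factor is the law of its
  coordinate. So the joint law of the coordinates is the product of their marginals, which is the
  distributional criterion for independence.\<close>

lemma indep_vars_PiM_coordinates:
  assumes "I \<noteq> {}" and M: "\<And>i. i \<in> I \<Longrightarrow> prob_space (M i)"
  shows "prob_space.indep_vars (PiM I M) M (\<lambda>i \<omega>. \<omega> i) I"
proof -
  interpret prob_space "PiM I M" by (rule prob_space_PiM) (rule M)
  have "distr (PiM I M) (PiM I M) (\<lambda>x. \<lambda>i\<in>I. x i) = distr (PiM I M) (PiM I M) (\<lambda>x. x)"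
    by (intro distr_cong) (auto simp: space_PiM PiE_def extensional_restrict)
  also have "\<dots> = PiM I M" by simp
  also have "\<dots> = PiM I (\<lambda>i. distr (PiM I M) (M i) (\<lambda>x. x i))"
    by (intro PiM_cong refl distr_PiM_component[OF M, symmetric])
  finally show ?thesis
    by (subst indep_vars_iff_distr_eq_PiM') (auto simp: assms)
qed

text \<open>Expanding the square leaves only the diagonal: for distinct indices independence makes
  the product integrable with mean the product of the means, which is 0.\<close>

lemma (in prob_space) expectation_square_sum:
  fixes X :: "'i \<Rightarrow> 'a \<Rightarrow> real"
  assumes "finite J" and ind: "indep_vars (\<lambda>_. borel) X J"
    and sq: "\<And>i. i \<in> J \<Longrightarrow> integrable M (\<lambda>x. (X i x)\<^sup>2)"
    and mean: "\<And>i. i \<in> J \<Longrightarrow> expectation (X i) = 0"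
  shows "integrable M (\<lambda>x. (\<Sum>i\<in>J. X i x)\<^sup>2)"
    and "expectation (\<lambda>x. (\<Sum>i\<in>J. X i x)\<^sup>2) = (\<Sum>i\<in>J. expectation (\<lambda>x. (X i x)\<^sup>2))"
proof -
  have rv: "random_variable borel (X i)" if "i \<in> J" for i
    using ind that by (auto simp: indep_vars_def)
  have int: "integrable M (X i)" if "i \<in> J" for i
    using square_integrable_imp_integrable[OF rv sq] that by blast
  have prod: "integrable M (\<lambda>x. X i x * X j x) \<and> expectation (\<lambda>x. X i x * X j x)
      = (if i = j then expectation (\<lambda>x. (X i x)\<^sup>2) else 0)" if "i \<in> J" "j \<in> J" for i j
  proof (cases "i = j")
    case True
    then show ?thesis using sq that by (simp add: power2_eq_square)
  next
    case False
    have iv: "indep_vars (\<lambda>_. borel) X {i, j}"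
      by (rule indep_vars_subset[OF ind]) (use that in auto)
    have "integrable M (\<lambda>x. \<Prod>k\<in>{i, j}. X k x)"
      and "expectation (\<lambda>x. \<Prod>k\<in>{i, j}. X k x) = (\<Prod>k\<in>{i, j}. expectation (X k))"
      using indep_vars_integrable[OF _ iv] indep_vars_lebesgue_integral[OF _ iv] int that by auto
    with False mean that show ?thesis by simp
  qed
  have eq: "(\<lambda>x. (\<Sum>i\<in>J. X i x)\<^sup>2) = (\<lambda>x. \<Sum>i\<in>J. \<Sum>j\<in>J. X i x * X j x)"
    by (simp add: power2_eq_square sum_product)
  show "integrable M (\<lambda>x. (\<Sum>i\<in>J. X i x)\<^sup>2)"
    unfolding eq using prod by (intro Bochner_Integration.integrable_sum) auto
  have "expectation (\<lambda>x. (\<Sum>i\<in>J. X i x)\<^sup>2) = (\<Sum>i\<in>J. \<Sum>j\<in>J. expectation (\<lambda>x. X i x * X j x))"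
    unfolding eq using prod
    by (subst Bochner_Integration.integral_sum)
      (auto intro!: sum.cong Bochner_Integration.integral_sum Bochner_Integration.integrable_sum)
  also have "\<dots> = (\<Sum>i\<in>J. \<Sum>j\<in>J. if i = j then expectation (\<lambda>x. (X i x)\<^sup>2) else 0)"
    using prod by (intro sum.cong) auto
  also have "\<dots> = (\<Sum>i\<in>J. expectation (\<lambda>x. (X i x)\<^sup>2))"
    using \<open>finite J\<close> by simp
  finally show "expectation (\<lambda>x. (\<Sum>i\<in>J. X i x)\<^sup>2) = (\<Sum>i\<in>J. expectation (\<lambda>x. (X i x)\<^sup>2))" .
qed

section \<open>Moments of the Gaussian noise coordinates\<close>

abbreviation std_normal :: "real measure" where
  "std_normal \<equiv> density lborel std_normal_density"

lemma prob_space_std_normal: "prob_space std_normal"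
  by (rule prob_space_normal_density) simp

lemma prob_space_noise_law: "prob_space (noise_law m)"
  unfolding noise_law_def by (rule prob_space_PiM) (auto intro: prob_space_std_normal)

lemma measurable_noise_coordinate:
  assumes "c \<in> {1..m} \<times> wav_index"
  shows "(\<lambda>Z. Z c) \<in> borel_measurable (noise_law m)"
proof -
  have "(\<lambda>Z. Z c) \<in> measurable (noise_law m) ((\<lambda>(k, i, j). std_normal) c)"
    unfolding noise_law_def by (rule measurable_component_singleton[OF assms])
  then show ?thesis by (simp add: case_prod_beta)
qed

lemma distr_noise_coordinate:
  assumes "c \<in> {1..m} \<times> wav_index"
  shows "distr (noise_law m) std_normal (\<lambda>Z. Z c) = std_normal"
  using distr_PiM_component[of "{1..m} \<times> wav_index" "\<lambda>(k, i, j). std_normal" c] assms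
  by (auto simp: noise_law_def case_prod_beta prob_space_std_normal)

text \<open>Under the standard normal law \<open>x\<close> and \<open>x ^ 2 - 1\<close> are the
  first two Hermite polynomials: centred, orthogonal, with squared norms 1 and 2. The proof reads
  this off the moments 1, 0, 1, 0, 3 of orders 0 to 4.\<close>

lemma std_normal_quadratic_moments:
  fixes a b :: real
  shows "integrable std_normal (\<lambda>x. (a * x + b * (x\<^sup>2 - 1))\<^sup>2)"
    and "(\<integral>x. a * x + b * (x\<^sup>2 - 1) \<partial>std_normal) = 0"
    and "(\<integral>x. (a * x + b * (x\<^sup>2 - 1))\<^sup>2 \<partial>std_normal) = a\<^sup>2 + 2 * b\<^sup>2"
proof -
  note mom = std_normal_moment_even[of 0] std_normal_moment_odd[of 0] std_normal_moment_even[of 1]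
    std_normal_moment_odd[of 1] std_normal_moment_even[of 2]
  have m0: "has_bochner_integral lborel (\<lambda>x. std_normal_density x) 1"
    and m1: "has_bochner_integral lborel (\<lambda>x. std_normal_density x * x) 0"
    and m2: "has_bochner_integral lborel (\<lambda>x. std_normal_density x * x\<^sup>2) 1"
    and m3: "has_bochner_integral lborel (\<lambda>x. std_normal_density x * x ^ 3) 0"
    and m4: "has_bochner_integral lborel (\<lambda>x. std_normal_density x * x ^ 4) 3"
    using mom by (simp_all add: fact_numeral numeral_3_eq_3[symmetric] del: One_nat_def)
  have "has_bochner_integral lborel
      (\<lambda>x. a * (std_normal_density x * x) + b * (std_normal_density x * x\<^sup>2 - std_normal_density x))
      (a * 0 + b * (1 - 1))"
    by (intro has_bochner_integral_add has_bochner_integral_diff has_bochner_integral_mult_right m0 m1 m2)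
  then have L: "has_bochner_integral lborel (\<lambda>x. std_normal_density x * (a * x + b * (x\<^sup>2 - 1))) 0"
    by (simp add: algebra_simps)
  then show "(\<integral>x. a * x + b * (x\<^sup>2 - 1) \<partial>std_normal) = 0"
    by (subst integral_density) (auto simp: has_bochner_integral_iff)
  \<comment> \<open>The expanded square is grouped by \<open>a ^ 2\<close>, \<open>2 * a * b\<close>
    and \<open>b ^ 2\<close>; odd moments remove the mixed group.\<close>
  have "has_bochner_integral lborel
      (\<lambda>x. a\<^sup>2 * (std_normal_density x * x\<^sup>2) + (2 * a * b) * (std_normal_density x * x ^ 3 - std_normal_density x * x)
        + b\<^sup>2 * (std_normal_density x * x ^ 4 - 2 * (std_normal_density x * x\<^sup>2) + std_normal_density x))
      (a\<^sup>2 * 1 + (2 * a * b) * (0 - 0) + b\<^sup>2 * (3 - 2 * 1 + 1))"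
    by (intro has_bochner_integral_add has_bochner_integral_diff has_bochner_integral_mult_right m0 m1 m2 m3 m4)
  then have Q: "has_bochner_integral lborel (\<lambda>x. std_normal_density x * (a * x + b * (x\<^sup>2 - 1))\<^sup>2) (a\<^sup>2 + 2 * b\<^sup>2)"
    by (simp add: algebra_simps power2_eq_square power3_eq_cube power4_eq_xxxx)
  then show "integrable std_normal (\<lambda>x. (a * x + b * (x\<^sup>2 - 1))\<^sup>2)"
    by (subst integrable_density) (auto simp: has_bochner_integral_iff)
  show "(\<integral>x. (a * x + b * (x\<^sup>2 - 1))\<^sup>2 \<partial>std_normal) = a\<^sup>2 + 2 * b\<^sup>2"
    using Q by (subst integral_density) (auto simp: has_bochner_integral_iff)
qed

text \<open>The summands are independent and centred, so their variances add. Two uses are intended: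
  the error of the level statistic, where \<open>b\<close> is \<open>1 / n\<close>, and the averaged
  noise in the posterior mean, where \<open>b\<close> is 0.\<close>

lemma expectation_square_noise_quadratic:
  fixes a b :: "nat \<times> nat \<times> nat \<Rightarrow> real"
  assumes "finite J" and J: "J \<subseteq> {1..m} \<times> wav_index"
  defines "Q \<equiv> (\<lambda>Z. \<Sum>c\<in>J. a c * Z c + b c * ((Z c)\<^sup>2 - 1))"
  shows "Q \<in> borel_measurable (noise_law m)"
    and "integrable (noise_law m) (\<lambda>Z. (Q Z)\<^sup>2)"
    and "(\<integral>Z. (Q Z)\<^sup>2 \<partial>noise_law m) = (\<Sum>c\<in>J. (a c)\<^sup>2 + 2 * (b c)\<^sup>2)"
proof -
  let ?X = "\<lambda>c Z. a c * Z c + b c * ((Z c)\<^sup>2 - 1) :: real"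
  interpret prob_space "noise_law m" by (rule prob_space_noise_law)
  have meas: "(\<lambda>Z. Z c) \<in> borel_measurable (noise_law m)" if "c \<in> J" for c
    using that J by (intro measurable_noise_coordinate) auto
  show "Q \<in> borel_measurable (noise_law m)"
    unfolding Q_def by (intro borel_measurable_sum borel_measurable_add borel_measurable_times
        borel_measurable_diff borel_measurable_power measurable_const meas) auto
  have tr: "distr (noise_law m) std_normal (\<lambda>Z. Z c) = std_normal" if "c \<in> J" for c
    using that J by (intro distr_noise_coordinate) auto
  \<comment> \<open>Here and in the next two facts \<open>std_normal\<close> is rewritten as the law
    of the coordinate \<open>c\<close>, which turns integrals over the line into expectations over
    the noise.\<close>
  have int: "integrable (noise_law m) (\<lambda>Z. (?X c Z)\<^sup>2)" if "c \<in> J" for c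
    using std_normal_quadratic_moments(1)[of "a c" "b c"] meas[OF that]
    by (subst (asm) tr[OF that, symmetric], subst (asm) integrable_distr_eq) auto
  have mean: "expectation (?X c) = 0" if "c \<in> J" for c
    using std_normal_quadratic_moments(2)[of "a c" "b c"] meas[OF that]
    by (subst (asm) tr[OF that, symmetric], subst (asm) integral_distr) auto
  have var: "expectation (\<lambda>Z. (?X c Z)\<^sup>2) = (a c)\<^sup>2 + 2 * (b c)\<^sup>2" if "c \<in> J" for c
    using std_normal_quadratic_moments(3)[of "a c" "b c"] meas[OF that]
    by (subst (asm) tr[OF that, symmetric], subst (asm) integral_distr) auto
  have ind: "indep_vars (\<lambda>_. borel) ?X J"
  proof (cases "J = {}")
    case True
    then show ?thesis by (simp add: indep_vars_def indep_sets_def)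
  next
    case False
    have "indep_vars (\<lambda>(k, i, j). std_normal) (\<lambda>c Z. Z c) ({1..m} \<times> wav_index)"
      unfolding noise_law_def
      by (rule indep_vars_PiM_coordinates) (use False J in \<open>auto intro: prob_space_std_normal\<close>)
    then have "indep_vars (\<lambda>(k, i, j). std_normal) (\<lambda>c Z. Z c) J"
      by (rule indep_vars_subset) (rule J)
    then show ?thesis
      by (rule indep_vars_compose2) (simp add: case_prod_beta)
  qed
  show "integrable (noise_law m) (\<lambda>Z. (Q Z)\<^sup>2)"
    unfolding Q_def by (rule expectation_square_sum(1)[OF \<open>finite J\<close> ind int mean])
  show "(\<integral>Z. (Q Z)\<^sup>2 \<partial>noise_law m) = (\<Sum>c\<in>J. (a c)\<^sup>2 + 2 * (b c)\<^sup>2)"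
    unfolding Q_def using expectation_square_sum(2)[OF \<open>finite J\<close> ind int mean] var
    by simp
qed

section \<open>Parseval and the truncation error\<close>

text \<open>The product is dominated by \<open>f ^ 2 + g ^ 2\<close>. This makes the inner product
  additive on \<open>L2_01\<close> and the space closed under sums and differences.\<close>

lemma L2_01_integrable_mult:
  assumes f: "f \<in> L2_01" and g: "g \<in> L2_01"
  shows "integrable (lebesgue_on {0..1}) (\<lambda>x. f x * g x)"
proof (rule Bochner_Integration.integrable_bound)
  show "integrable (lebesgue_on {0..1}) (\<lambda>x. (f x)\<^sup>2 + (g x)\<^sup>2)"
    using f g by (auto simp: L2_01_def)
  show "(\<lambda>x. f x * g x) \<in> borel_measurable (lebesgue_on {0..1})"
    using f g by (auto simp: L2_01_def)
  have "\<bar>u * v\<bar> \<le> u\<^sup>2 + v\<^sup>2" for u v :: real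
    using zero_le_power2[of "\<bar>u\<bar> - \<bar>v\<bar>"] zero_le_power2[of u] zero_le_power2[of v]
    unfolding power2_diff abs_mult power2_abs by linarith
  then show "AE x in lebesgue_on {0..1}. norm (f x * g x) \<le> norm ((f x)\<^sup>2 + (g x)\<^sup>2)"
    by simp
qed

lemma L2_01_diff: "f \<in> L2_01 \<Longrightarrow> g \<in> L2_01 \<Longrightarrow> (\<lambda>x. f x - g x) \<in> L2_01"
  using L2_01_integrable_mult[of f f] L2_01_integrable_mult[of g g] L2_01_integrable_mult[of f g]
  by (auto simp: L2_01_def power2_diff power2_eq_square[symmetric] mult.assoc)

lemma L2_01_add: "f \<in> L2_01 \<Longrightarrow> g \<in> L2_01 \<Longrightarrow> (\<lambda>x. f x + g x) \<in> L2_01"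
  using L2_01_integrable_mult[of f f] L2_01_integrable_mult[of g g] L2_01_integrable_mult[of f g]
  by (auto simp: L2_01_def power2_sum power2_eq_square[symmetric] mult.assoc)

lemma L2_01_cmult: "f \<in> L2_01 \<Longrightarrow> (\<lambda>x. a * f x) \<in> L2_01"
  by (auto simp: L2_01_def power_mult_distrib)

lemma L2_01_sum: "(\<And>c. c \<in> S \<Longrightarrow> f c \<in> L2_01) \<Longrightarrow> (\<lambda>x. \<Sum>c\<in>S. f c x) \<in> L2_01"
proof (induction S rule: infinite_finite_induct)
  case (insert c S)
  then show ?case using L2_01_add[of "f c" "\<lambda>x. \<Sum>c\<in>S. f c x"] by simp
qed (auto simp: L2_01_def)

lemma inner_01_commute: "inner_01 f g = inner_01 g f"
  by (simp add: inner_01_def mult.commute)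

lemma norm_01_square: "(norm_01 f)\<^sup>2 = inner_01 f f"
  by (simp add: norm_01_def inner_01_def power2_eq_square)

lemma inner_01_diff_left:
  "f \<in> L2_01 \<Longrightarrow> g \<in> L2_01 \<Longrightarrow> h \<in> L2_01 \<Longrightarrow>
    inner_01 (\<lambda>x. f x - g x) h = inner_01 f h - inner_01 g h"
  by (simp add: inner_01_def left_diff_distrib L2_01_integrable_mult)

lemma inner_01_sum_left:
  assumes "\<And>c. c \<in> S \<Longrightarrow> f c \<in> L2_01" "h \<in> L2_01"
  shows "inner_01 (\<lambda>x. \<Sum>c\<in>S. a c * f c x) h = (\<Sum>c\<in>S. a c * inner_01 (f c) h)"
  using assms
  by (simp add: inner_01_def sum_distrib_right mult.assoc L2_01_integrable_mult Bochner_Integration.integral_sum)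

text \<open>Flattening whole levels into one set of index pairs turns double sums into single sums
  over a finite subset of \<open>wav_index\<close>, the form in which orthonormality
  applies.\<close>

definition level_block :: "nat set \<Rightarrow> (nat \<times> nat) set" where
  "level_block I = (SIGMA i:I. {..<2 ^ i})"

lemma level_block_subset: "level_block I \<subseteq> wav_index"
  by (auto simp: level_block_def wav_index_def)

lemma finite_level_block: "finite I \<Longrightarrow> finite (level_block I)"
  by (simp add: level_block_def)

lemma sum_level_block:
  "finite I \<Longrightarrow> (\<Sum>i\<in>I. \<Sum>j<2 ^ i. f i j) = (\<Sum>(i, j)\<in>level_block I. f i j)"
  by (simp add: level_block_def sum.Sigma)

section \<open>Expansions in an orthonormal basis\<close>

context
  fixes \<psi> :: "nat \<Rightarrow> nat \<Rightarrow> real \<Rightarrow> real"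
  assumes basis: "orthonormal_basis_01 \<psi>"
begin

lemma basis_L2: "c \<in> wav_index \<Longrightarrow> case_prod \<psi> c \<in> L2_01"
  using basis by (auto simp: orthonormal_basis_01_def)

lemma inner_01_basis:
  "c \<in> wav_index \<Longrightarrow> d \<in> wav_index \<Longrightarrow>
    inner_01 (case_prod \<psi> c) (case_prod \<psi> d) = (if c = d then 1 else 0)"
  using basis by (auto simp: orthonormal_basis_01_def split: prod.splits)

lemma inner_01_expansion_basis:
  assumes "finite S" "S \<subseteq> wav_index" "d \<in> wav_index"
  shows "inner_01 (\<lambda>x. \<Sum>c\<in>S. a c * case_prod \<psi> c x) (case_prod \<psi> d) = (if d \<in> S then a d else 0)"
proof -
  have "inner_01 (\<lambda>x. \<Sum>c\<in>S. a c * case_prod \<psi> c x) (case_prod \<psi> d)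
      = (\<Sum>c\<in>S. a c * inner_01 (case_prod \<psi> c) (case_prod \<psi> d))"
    by (rule inner_01_sum_left) (use assms basis_L2 in auto)
  also have "\<dots> = (\<Sum>c\<in>S. if c = d then a c else 0)"
    using assms(3) by (intro sum.cong refl) (simp add: inner_01_basis subsetD[OF assms(2)])
  also have "\<dots> = (if d \<in> S then a d else 0)"
    using \<open>finite S\<close> by (simp add: sum.delta')
  finally show ?thesis .
qed

text \<open>Pythagoras: the inner products of the projection with \<open>h\<close> and with itself
  both equal the sum of the squared coefficients, so in the expanded square they enter as minus two
  copies plus one.\<close>

lemma norm_01_residual:
  assumes h: "h \<in> L2_01" and S: "finite S" "S \<subseteq> wav_index"
  defines "a \<equiv> \<lambda>c. inner_01 h (case_prod \<psi> c)"
  shows "(norm_01 (\<lambda>x. h x - (\<Sum>c\<in>S. a c * case_prod \<psi> c x)))\<^sup>2 = (norm_01 h)\<^sup>2 - (\<Sum>c\<in>S. (a c)\<^sup>2)"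
proof -
  let ?P = "\<lambda>x. \<Sum>c\<in>S. a c * case_prod \<psi> c x"
  have P: "?P \<in> L2_01"
    using S basis_L2 by (intro L2_01_sum L2_01_cmult) auto
  have hP: "inner_01 ?P h = (\<Sum>c\<in>S. (a c)\<^sup>2)"
    using S basis_L2 h
    by (subst inner_01_sum_left) (auto simp: a_def power2_eq_square inner_01_commute[of h])
  have PP: "inner_01 ?P ?P = (\<Sum>c\<in>S. (a c)\<^sup>2)"
  proof -
    have "inner_01 ?P ?P = (\<Sum>c\<in>S. a c * inner_01 (case_prod \<psi> c) ?P)"
      by (rule inner_01_sum_left) (use S basis_L2 P in auto)
    also have "\<dots> = (\<Sum>c\<in>S. a c * a c)"
      by (intro sum.cong refl, subst inner_01_commute)
        (simp add: inner_01_expansion_basis S subsetD[OF S(2)])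
    finally show ?thesis by (simp add: power2_eq_square)
  qed
  have "(norm_01 (\<lambda>x. h x - ?P x))\<^sup>2 = inner_01 h (\<lambda>x. h x - ?P x) - inner_01 ?P (\<lambda>x. h x - ?P x)"
    unfolding norm_01_square by (intro inner_01_diff_left h P L2_01_diff)
  also have "inner_01 h (\<lambda>x. h x - ?P x) = inner_01 h h - inner_01 ?P h"
    by (subst inner_01_commute) (intro inner_01_diff_left h P)
  also have "inner_01 ?P (\<lambda>x. h x - ?P x) = inner_01 h ?P - inner_01 ?P ?P"
    by (subst inner_01_commute) (intro inner_01_diff_left h P)
  finally show ?thesis
    using hP PP by (simp add: norm_01_square inner_01_commute[of h ?P])
qed

text \<open>Completeness says that the residual norms tend to 0, and \<open>norm_01_residual\<close>
  converts them into partial sums of squares.\<close>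

lemma parseval_01:
  assumes h: "h \<in> L2_01"
  shows "(\<lambda>N. \<Sum>c\<in>level_block {..<N}. (inner_01 h (case_prod \<psi> c))\<^sup>2) \<longlonglongrightarrow> (norm_01 h)\<^sup>2"
proof -
  let ?R = "\<lambda>N. norm_01 (\<lambda>x. h x - (\<Sum>c\<in>level_block {..<N}. inner_01 h (case_prod \<psi> c) * case_prod \<psi> c x))"
  have "?R \<longlonglongrightarrow> 0"
    using basis h by (auto simp: orthonormal_basis_01_def sum_level_block case_prod_beta)
  then have "(\<lambda>N. (norm_01 h)\<^sup>2 - (?R N)\<^sup>2) \<longlonglongrightarrow> (norm_01 h)\<^sup>2 - 0\<^sup>2"
    by (intro tendsto_intros)
  then show ?thesis
    by (simp add: norm_01_residual[OF h finite_level_block level_block_subset])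
qed

text \<open>This splits the loss of a truncated series into coefficient error and squared bias: the
  difference has coefficients \<theta> minus those of \<open>f\<close> up to level \<open>l\<close>,
  and minus those of \<open>f\<close> above. The bias enters through finite tail sums bounded
  uniformly in \<open>N\<close>.\<close>

lemma norm_01_truncation_error:
  fixes \<theta> :: "nat \<times> nat \<Rightarrow> real"
  assumes f: "f \<in> L2_01"
    and tail: "\<And>N. (\<Sum>i\<in>{l<..<N}. \<Sum>j<2 ^ i. (inner_01 f (\<psi> i j))\<^sup>2) \<le> T"
  shows "(norm_01 (\<lambda>x. (\<Sum>i\<le>l. \<Sum>j<2 ^ i. \<theta> (i, j) * \<psi> i j x) - f x))\<^sup>2
    \<le> (\<Sum>i\<le>l. \<Sum>j<2 ^ i. (\<theta> (i, j) - inner_01 f (\<psi> i j))\<^sup>2) + T"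
proof -
  let ?S = "level_block {..l}"
  define h where "h = (\<lambda>x. (\<Sum>c\<in>?S. \<theta> c * case_prod \<psi> c x) - f x)"
  have heq: "(\<lambda>x. (\<Sum>i\<le>l. \<Sum>j<2 ^ i. \<theta> (i, j) * \<psi> i j x) - f x) = h"
    by (simp add: h_def sum_level_block case_prod_beta)
  have P: "(\<lambda>x. \<Sum>c\<in>?S. \<theta> c * case_prod \<psi> c x) \<in> L2_01"
    using level_block_subset basis_L2 by (intro L2_01_sum L2_01_cmult) blast
  have h: "h \<in> L2_01"
    unfolding h_def by (intro L2_01_diff P f)
  have coef: "inner_01 h (case_prod \<psi> c) = (if c \<in> ?S then \<theta> c else 0) - inner_01 f (case_prod \<psi> c)"
    if "c \<in> wav_index" for c
    unfolding h_def using that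
    by (simp only: inner_01_diff_left[OF P f basis_L2[OF that]]
        inner_01_expansion_basis[OF finite_level_block[OF finite_atMost] level_block_subset that])
  have bound: "(\<Sum>c\<in>level_block {..<N}. (inner_01 h (case_prod \<psi> c))\<^sup>2)
      \<le> (\<Sum>i\<le>l. \<Sum>j<2 ^ i. (\<theta> (i, j) - inner_01 f (\<psi> i j))\<^sup>2) + T" if "N > l" for N
  proof -
    have "(\<Sum>c\<in>level_block {..<N}. (inner_01 h (case_prod \<psi> c))\<^sup>2)
        = (\<Sum>i<N. \<Sum>j<2 ^ i. (inner_01 h (\<psi> i j))\<^sup>2)"
      by (simp add: sum_level_block case_prod_beta)
    also have "\<dots>
        = (\<Sum>i\<le>l. \<Sum>j<2 ^ i. (inner_01 h (\<psi> i j))\<^sup>2) + (\<Sum>i\<in>{l<..<N}. \<Sum>j<2 ^ i. (inner_01 h (\<psi> i j))\<^sup>2)"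
      using that by (subst sum.union_disjoint[symmetric]) (auto intro!: sum.cong)
    also have "(\<Sum>i\<le>l. \<Sum>j<2 ^ i. (inner_01 h (\<psi> i j))\<^sup>2)
        = (\<Sum>i\<le>l. \<Sum>j<2 ^ i. (\<theta> (i, j) - inner_01 f (\<psi> i j))\<^sup>2)"
      using coef by (intro sum.cong refl) (force simp: wav_index_def level_block_def)
    also have "(\<Sum>i\<in>{l<..<N}. \<Sum>j<2 ^ i. (inner_01 h (\<psi> i j))\<^sup>2)
        = (\<Sum>i\<in>{l<..<N}. \<Sum>j<2 ^ i. (inner_01 f (\<psi> i j))\<^sup>2)"
      using coef by (intro sum.cong refl) (force simp: wav_index_def level_block_def)
    finally show ?thesis using tail[of N] by simp
  qed
  \<comment> \<open>Parseval's partial sums obey the bound once \<open>N > l\<close>, so their limit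
    does.\<close>
  show ?thesis unfolding heq
    by (rule LIMSEQ_le_const2[OF parseval_01[OF h]]) (use bound in \<open>auto intro!: exI[of _ "Suc l"]\<close>)
qed

end

section \<open>Fluctuations of the level statistic\<close>

definition level_energy :: "(nat \<Rightarrow> nat \<Rightarrow> real) \<Rightarrow> nat \<Rightarrow> nat \<Rightarrow> real" where
  "level_energy \<theta> a b = (\<Sum>i=a..b. \<Sum>j<2 ^ i. (\<theta> i j)\<^sup>2)"

text \<open>This is the error of the unbiased estimate of the signal energy in levels
  \<open>a\<close> to \<open>b\<close>.\<close>

definition fluctuation ::
  "(nat \<Rightarrow> nat \<Rightarrow> real) \<Rightarrow> nat \<Rightarrow> nat \<Rightarrow> nat \<Rightarrow> nat \<Rightarrow> (nat \<times> nat \<times> nat \<Rightarrow> real) \<Rightarrow> real" where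
  "fluctuation \<theta> n m a b Z =
     (\<Sum>i=a..b. T_tilde n m (observations \<theta> n m Z) i) - level_energy \<theta> a b"

text \<open>Squaring an observation and dividing by \<open>m\<close> yields signal, a linear noise
  term and \<open>Z ^ 2 / n\<close>. Centring the last releases \<open>1 / n\<close> per machine and
  position, hence \<open>2 ^ i * m / n\<close> on level \<open>i\<close>, exactly what
  \<open>T_tilde\<close> subtracts.\<close>

lemma fluctuation_eq:
  assumes "m \<ge> 1" "n \<ge> 1"
  shows "fluctuation \<theta> n m a b Z =
    (\<Sum>(k, i, j)\<in>{1..m} \<times> level_block {a..b}.
       2 * sqrt (m / n) / m * \<theta> i j * Z (k, i, j) + 1 / n * ((Z (k, i, j))\<^sup>2 - 1))"
proof -
  let ?q = "\<lambda>k i j. 2 * sqrt (m / n) / m * \<theta> i j * Z (k, i, j) + 1 / n * ((Z (k, i, j))\<^sup>2 - 1)"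
  have sq: "(\<theta> i j + sqrt (m / n) * z)\<^sup>2 / m = (\<theta> i j)\<^sup>2 / m + 1 / n
      + (2 * sqrt (m / n) / m * \<theta> i j * z + 1 / n * (z\<^sup>2 - 1))" for i j z
    using assms by (simp add: power2_sum power_mult_distrib field_simps)
  have "T_tilde n m (observations \<theta> n m Z) i = (\<Sum>j<2 ^ i. (\<theta> i j)\<^sup>2) + (\<Sum>k=1..m. \<Sum>j<2 ^ i. ?q k i j)" for i
  proof -
    have "2 ^ i * T_avg m (observations \<theta> n m Z) i
        = (\<Sum>k=1..m. \<Sum>j<2 ^ i. (\<theta> i j + sqrt (m / n) * Z (k, i, j))\<^sup>2 / m)"
      by (simp add: T_avg_def T_local_def observations_def sum_divide_distrib sum_distrib_left)
    also have "\<dots> = (\<Sum>k=1..m. (\<Sum>j<2 ^ i. (\<theta> i j)\<^sup>2) / m + 2 ^ i / n + (\<Sum>j<2 ^ i. ?q k i j))"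
      unfolding sq sum.distrib by (simp add: sum_divide_distrib)
    also have "\<dots> = (\<Sum>j<2 ^ i. (\<theta> i j)\<^sup>2) + 2 ^ i * m / n + (\<Sum>k=1..m. \<Sum>j<2 ^ i. ?q k i j)"
      unfolding sum.distrib using assms by simp
    finally show ?thesis by (simp add: T_tilde_def)
  qed
  then have "fluctuation \<theta> n m a b Z = (\<Sum>i=a..b. \<Sum>k=1..m. \<Sum>j<2 ^ i. ?q k i j)"
    by (simp add: fluctuation_def level_energy_def sum.distrib)
  also have "\<dots> = (\<Sum>k=1..m. \<Sum>i=a..b. \<Sum>j<2 ^ i. ?q k i j)"
    by (rule sum.swap)
  also have "\<dots> = (\<Sum>(k, i, j)\<in>{1..m} \<times> level_block {a..b}. ?q k i j)"
    by (simp add: sum_level_block sum.cartesian_product case_prod_beta)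
  finally show ?thesis .
qed

lemma sum_two_power_le: "(\<Sum>i=a..b. 2 ^ i :: real) \<le> 2 * 2 ^ b"
proof -
  have "(\<Sum>i\<le>b. 2 ^ i :: real) = 2 * 2 ^ b - 1"
    by (induction b) auto
  moreover have "(\<Sum>i=a..b. 2 ^ i :: real) \<le> (\<Sum>i\<le>b. 2 ^ i)"
    by (intro sum_mono2) auto
  ultimately show ?thesis by simp
qed

text \<open>The linear coefficients square to \<open>4 / (m * n)\<close> times the squared signal,
  and summing over \<open>m\<close> machines gives the energy term. Each quadratic part contributes
  \<open>2 / n ^ 2\<close>, and there are at most \<open>m * 2 * 2 ^ b\<close> coordinates.\<close>

lemma fluctuation_moment:
  assumes "m \<ge> 1" "n \<ge> 1"
  shows "fluctuation \<theta> n m a b \<in> borel_measurable (noise_law m)"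
    and "integrable (noise_law m) (\<lambda>Z. (fluctuation \<theta> n m a b Z)\<^sup>2)"
    and "(\<integral>Z. (fluctuation \<theta> n m a b Z)\<^sup>2 \<partial>noise_law m) \<le> 4 * level_energy \<theta> a b / real n + 4 * 2 ^ b * real m / (real n)\<^sup>2"
proof -
  let ?J = "{1..m} \<times> level_block {a..b}"
  let ?a = "\<lambda>(k::nat, i, j). 2 * sqrt (m / n) / m * \<theta> i j" and ?b = "\<lambda>c::nat \<times> nat \<times> nat. 1 / real n"
  have J: "finite ?J" "?J \<subseteq> {1..m} \<times> wav_index"
    using level_block_subset by (auto intro!: finite_level_block)
  have eq: "fluctuation \<theta> n m a b = (\<lambda>Z. \<Sum>c\<in>?J. ?a c * Z c + ?b c * ((Z c)\<^sup>2 - 1))"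
    by (simp add: fun_eq_iff fluctuation_eq[OF assms] case_prod_beta)
  show "fluctuation \<theta> n m a b \<in> borel_measurable (noise_law m)"
    unfolding eq by (rule expectation_square_noise_quadratic(1)[OF J])
  show "integrable (noise_law m) (\<lambda>Z. (fluctuation \<theta> n m a b Z)\<^sup>2)"
    unfolding eq by (rule expectation_square_noise_quadratic(2)[OF J])
  have "(\<integral>Z. (fluctuation \<theta> n m a b Z)\<^sup>2 \<partial>noise_law m) = (\<Sum>c\<in>?J. (?a c)\<^sup>2 + 2 * (?b c)\<^sup>2)"
    unfolding eq by (rule expectation_square_noise_quadratic(3)[OF J])
  also have "\<dots> = (\<Sum>(k, i, j)\<in>?J. 4 / (real m * n) * (\<theta> i j)\<^sup>2 + 2 / (real n)\<^sup>2)"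
  proof -
    have "(2 * sqrt (m / n) / m * x)\<^sup>2 + 2 * (1 / real n)\<^sup>2 = 4 / (real m * n) * x\<^sup>2 + 2 / (real n)\<^sup>2" for x
      using assms by (simp add: power_mult_distrib power_divide power2_eq_square[of "real m"])
    then show ?thesis by (simp add: case_prod_beta)
  qed
  also have "\<dots> = (\<Sum>k=1..m. \<Sum>i=a..b. \<Sum>j<2 ^ i. 4 / (real m * n) * (\<theta> i j)\<^sup>2 + 2 / (real n)\<^sup>2)"
    by (simp add: sum_level_block sum.cartesian_product case_prod_beta del: sum_constant)
  also have "\<dots> = 4 * level_energy \<theta> a b / real n + 2 * real m / (real n)\<^sup>2 * (\<Sum>i=a..b. 2 ^ i)"
  proof -
    have "(\<Sum>k=1..m. \<Sum>i=a..b. \<Sum>j<2 ^ i. 4 / (real m * n) * (\<theta> i j)\<^sup>2 + 2 / (real n)\<^sup>2)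
        = m * (4 / (real m * n) * level_energy \<theta> a b + 2 / (real n)\<^sup>2 * (\<Sum>i=a..b. 2 ^ i))"
      by (simp add: sum.distrib sum_distrib_left sum_divide_distrib level_energy_def mult.commute)
    then show ?thesis using assms by (simp add: distrib_left)
  qed
  also have "\<dots> \<le> 4 * level_energy \<theta> a b / real n + 2 * real m / (real n)\<^sup>2 * (2 * 2 ^ b)"
    by (intro add_left_mono mult_left_mono sum_two_power_le) simp
  finally show "(\<integral>Z. (fluctuation \<theta> n m a b Z)\<^sup>2 \<partial>noise_law m)
      \<le> 4 * level_energy \<theta> a b / real n + 4 * 2 ^ b * real m / (real n)\<^sup>2"
    by (simp add: mult_ac)
qed

lemma fluctuation_tail:
  assumes "m \<ge> 1" "n \<ge> 1" "t > 0"
  shows "{Z \<in> space (noise_law m). t \<le> \<bar>fluctuation \<theta> n m a b Z\<bar>} \<in> sets (noise_law m)"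
    and "measure (noise_law m) {Z \<in> space (noise_law m). t \<le> \<bar>fluctuation \<theta> n m a b Z\<bar>}
      \<le> (4 * level_energy \<theta> a b / real n + 4 * 2 ^ b * real m / (real n)\<^sup>2) / t\<^sup>2"
proof -
  interpret prob_space "noise_law m" by (rule prob_space_noise_law)
  note [measurable] = fluctuation_moment(1)[OF assms(1,2), of \<theta> a b]
  show "{Z \<in> space (noise_law m). t \<le> \<bar>fluctuation \<theta> n m a b Z\<bar>} \<in> sets (noise_law m)"
    by measurable
  have "prob {Z \<in> space (noise_law m). t \<le> \<bar>fluctuation \<theta> n m a b Z\<bar>}
      \<le> expectation (\<lambda>Z. (fluctuation \<theta> n m a b Z)\<^sup>2) / t\<^sup>2"
    by (rule second_moment_method) (use fluctuation_moment[OF assms(1,2)] assms in auto)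
  also have "\<dots> \<le> (4 * level_energy \<theta> a b / real n + 4 * 2 ^ b * real m / (real n)\<^sup>2) / t\<^sup>2"
    by (rule divide_right_mono[OF fluctuation_moment(3)[OF assms(1,2)]]) simp
  finally show "prob {Z \<in> space (noise_law m). t \<le> \<bar>fluctuation \<theta> n m a b Z\<bar>}
      \<le> (4 * level_energy \<theta> a b / real n + 4 * 2 ^ b * real m / (real n)\<^sup>2) / t\<^sup>2" .
qed

section \<open>The posterior given the data\<close>

text \<open>Bias-variance decomposition: expanding around the mean, the mixed term vanishes with the
  first central moment.\<close>

lemma nn_integral_normal_square:
  assumes "\<sigma> > 0"
  shows "(\<integral>\<^sup>+x. ennreal ((x - c)\<^sup>2) \<partial>density lborel (normal_density \<mu> \<sigma>)) = ennreal (\<sigma>\<^sup>2 + (\<mu> - c)\<^sup>2)"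
proof -
  let ?d = "normal_density \<mu> \<sigma>"
  note mom = normal_moment_even[OF assms, of \<mu> 0] normal_moment_odd[OF assms, of \<mu> 0]
    normal_moment_even[OF assms, of \<mu> 1]
  have m0: "has_bochner_integral lborel ?d 1"
    and m1: "has_bochner_integral lborel (\<lambda>x. ?d x * (x - \<mu>)) 0"
    and m2: "has_bochner_integral lborel (\<lambda>x. ?d x * (x - \<mu>)\<^sup>2) (\<sigma>\<^sup>2)"
    using mom by simp_all
  have "has_bochner_integral lborel
      (\<lambda>x. ?d x * (x - \<mu>)\<^sup>2 + 2 * (\<mu> - c) * (?d x * (x - \<mu>)) + (\<mu> - c)\<^sup>2 * ?d x)
      (\<sigma>\<^sup>2 + 2 * (\<mu> - c) * 0 + (\<mu> - c)\<^sup>2 * 1)"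
    by (intro has_bochner_integral_add has_bochner_integral_mult_right m0 m1 m2)
  then have *: "has_bochner_integral lborel (\<lambda>x. ?d x * (x - c)\<^sup>2) (\<sigma>\<^sup>2 + (\<mu> - c)\<^sup>2)"
    by (simp add: algebra_simps power2_eq_square)
  have "(\<integral>\<^sup>+x. ennreal ((x - c)\<^sup>2) \<partial>density lborel ?d) = (\<integral>\<^sup>+x. ennreal (?d x * (x - c)\<^sup>2) \<partial>lborel)"
    by (subst nn_integral_density) (auto simp: ennreal_mult)
  also have "\<dots> = ennreal (\<sigma>\<^sup>2 + (\<mu> - c)\<^sup>2)"
    using * by (subst nn_integral_eq_integral) (auto simp: has_bochner_integral_iff)
  finally show ?thesis .
qed

text \<open>The average over machines, shrunk by \<open>n / (n + 1)\<close>.\<close>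

definition posterior_mean :: "nat \<Rightarrow> nat \<Rightarrow> (nat \<Rightarrow> nat \<Rightarrow> nat \<Rightarrow> real) \<Rightarrow> nat \<Rightarrow> nat \<Rightarrow> real" where
  "posterior_mean n m y i j = real n / (real m * (real n + 1)) * (\<Sum>k=1..m. y k i j)"

context
  fixes s_min s_max \<tau> :: real and n m :: nat and y :: "nat \<Rightarrow> nat \<Rightarrow> nat \<Rightarrow> real"
begin

private abbreviation "post \<equiv> posterior_coeffs s_min s_max \<tau> n m y"
private abbreviation "lh \<equiv> l_hat s_min s_max \<tau> n m y"

private definition coeff_law :: "nat \<times> nat \<Rightarrow> real measure" where
  "coeff_law = (\<lambda>(i, j). if i \<le> lh
        then density lborel (normal_density (posterior_mean n m y i j) (sqrt (1 / (real n + 1))))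
        else return borel 0)"

private lemma post_eq: "post = PiM wav_index coeff_law"
  unfolding posterior_coeffs_def coeff_law_def posterior_mean_def ..

private lemma prob_space_coeff_law: "prob_space (coeff_law c)"
  by (auto simp: coeff_law_def split: prod.splits intro!: prob_space_normal_density prob_space_return)

private lemma sets_coeff_law [measurable_cong]: "sets (coeff_law c) = sets borel"
  by (auto simp: coeff_law_def split: prod.splits)

lemma prob_space_posterior: "prob_space post"
  unfolding post_eq by (rule prob_space_PiM) (rule prob_space_coeff_law)

private lemma measurable_coeff: "c \<in> wav_index \<Longrightarrow> (\<lambda>\<theta>. \<theta> c) \<in> borel_measurable post"
  using measurable_component_singleton[of c wav_index coeff_law]
  by (simp add: post_eq cong: measurable_cong_sets)

private lemma nn_integral_coeff:
  assumes "i \<le> lh" "j < 2 ^ i"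
  shows "(\<integral>\<^sup>+\<theta>. ennreal ((\<theta> (i, j) - c)\<^sup>2) \<partial>post)
    = ennreal (1 / (real n + 1) + (posterior_mean n m y i j - c)\<^sup>2)"
proof -
  have ij: "(i, j) \<in> wav_index" using assms by (simp add: wav_index_def)
  have "(\<integral>\<^sup>+\<theta>. ennreal ((\<theta> (i, j) - c)\<^sup>2) \<partial>post)
      = (\<integral>\<^sup>+x. ennreal ((x - c)\<^sup>2) \<partial>distr (PiM wav_index coeff_law) (coeff_law (i, j)) (\<lambda>\<theta>. \<theta> (i, j)))"
    unfolding post_eq using ij by (subst nn_integral_distr) auto
  also have "\<dots> = (\<integral>\<^sup>+x. ennreal ((x - c)\<^sup>2) \<partial>coeff_law (i, j))"
    by (subst distr_PiM_component) (auto simp: ij prob_space_coeff_law)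
  also have "\<dots> = ennreal (1 / (real n + 1) + (posterior_mean n m y i j - c)\<^sup>2)"
    using assms(1) by (simp add: coeff_law_def nn_integral_normal_square)
  finally show ?thesis .
qed

text \<open>The index set is countable, so the null sets of the single coefficients can be united.
  Off this set the wavelet series is a finite sum.\<close>

private lemma AE_coeff_zero: "AE \<theta> in post. \<forall>(i, j)\<in>wav_index. i > lh \<longrightarrow> \<theta> (i, j) = 0"
proof -
  have "AE \<theta> in post. \<forall>c\<in>wav_index. fst c > lh \<longrightarrow> \<theta> c = 0"
  proof (subst AE_ball_countable)
    show "countable wav_index" by simp
    show "\<forall>c\<in>wav_index. AE \<theta> in post. fst c > lh \<longrightarrow> \<theta> c = 0"
    proof
      fix c :: "nat \<times> nat" assume c: "c \<in> wav_index"
      have ret: "AE x in return borel (0 :: real). fst c > lh \<longrightarrow> x = 0"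
        by (subst AE_return) auto
      have "AE x in coeff_law c. fst c > lh \<longrightarrow> x = 0"
      proof (cases "fst c > lh")
        case True
        then have "coeff_law c = return borel 0"
          by (cases c) (simp add: coeff_law_def)
        with ret show ?thesis by (simp only:)
      qed simp
      then show "AE \<theta> in post. fst c > lh \<longrightarrow> \<theta> c = 0"
        unfolding post_eq by (rule AE_PiM_component[OF prob_space_coeff_law c])
    qed
  qed
  then show ?thesis by eventually_elim auto
qed

text \<open>\<open>T\<close> bounds the squared bias beyond the selected level. By
  \<open>norm_01_truncation_error\<close> a loss of at least \<open>R'\<close> then forces a
  coefficient error of at least \<open>R\<close>, whose posterior probability Markov's inequality
  bounds by the second moment.\<close>

lemma posterior_prob_le:
  assumes basis: "orthonormal_basis_01 \<psi>" and f: "f \<in> L2_01"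
    and tail: "\<And>N. (\<Sum>i\<in>{lh<..<N}. \<Sum>j<2 ^ i. (inner_01 f (\<psi> i j))\<^sup>2) \<le> T"
    and R: "R > 0" "R + T \<le> R'"
  shows "posterior_prob \<psi> s_min s_max \<tau> n m y {g. R' \<le> (norm_01 (\<lambda>x. g x - f x))\<^sup>2}
    \<le> ennreal ((\<Sum>i\<le>lh. \<Sum>j<2 ^ i. 1 / (real n + 1) + (posterior_mean n m y i j - inner_01 f (\<psi> i j))\<^sup>2) / R)"
proof -
  let ?Q = "\<lambda>\<theta> :: nat \<times> nat \<Rightarrow> real. \<Sum>i\<le>lh. \<Sum>j<2 ^ i. (\<theta> (i, j) - inner_01 f (\<psi> i j))\<^sup>2"
  let ?A = "{\<theta> \<in> space post. wavelet_series \<psi> \<theta> \<in> {g. R' \<le> (norm_01 (\<lambda>x. g x - f x))\<^sup>2}}"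
  let ?B = "{\<theta> \<in> space post. 1 \<le> ennreal (1 / R) * ennreal (?Q \<theta>)}"
  have meas: "(\<lambda>\<theta>. (\<theta> (i, j) - inner_01 f (\<psi> i j))\<^sup>2) \<in> borel_measurable post" if "j < 2 ^ i" for i j
    using that by (intro borel_measurable_power borel_measurable_diff measurable_const measurable_coeff)
      (auto simp: wav_index_def)
  have [measurable]: "?Q \<in> borel_measurable post"
    using meas by (intro borel_measurable_sum) auto
  have "posterior_prob \<psi> s_min s_max \<tau> n m y {g. R' \<le> (norm_01 (\<lambda>x. g x - f x))\<^sup>2} = emeasure post ?A"
    by (simp add: posterior_prob_def)
  also have "\<dots> \<le> emeasure post ?B"
  \<comment> \<open>The condition \<open>R \<le> ?Q \<theta>\<close> is written as
    \<open>1 \<le> 1 / R * ?Q \<theta>\<close> in \<open>?B\<close> to match the Markov inequality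
    for nonnegative integrals.\<close>
  proof (rule emeasure_mono_AE)
    show "?B \<in> sets post" by measurable
    show "AE \<theta> in post. \<theta> \<in> ?A \<longrightarrow> \<theta> \<in> ?B"
      using AE_coeff_zero
    proof eventually_elim
      case (elim \<theta>)
      have "wavelet_series \<psi> \<theta> x = (\<Sum>i\<le>lh. \<Sum>j<2 ^ i. \<theta> (i, j) * \<psi> i j x)" for x
        unfolding wavelet_series_def
        by (rule suminf_finite) (use elim in \<open>auto simp: wav_index_def intro!: sum.neutral\<close>)
      then have ws: "wavelet_series \<psi> \<theta> = (\<lambda>x. \<Sum>i\<le>lh. \<Sum>j<2 ^ i. \<theta> (i, j) * \<psi> i j x)"
        by (rule ext)
      show ?case
      proof
        assume "\<theta> \<in> ?A"
        then have "R' \<le> ?Q \<theta> + T" and sp: "\<theta> \<in> space post"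
          using norm_01_truncation_error[OF basis f tail, of \<theta>] by (auto simp: ws)
        then have "1 \<le> 1 / R * ?Q \<theta>"
          using R by (simp add: field_simps)
        then show "\<theta> \<in> ?B"
          using sp R by (simp add: ennreal_mult[symmetric] sum_nonneg ennreal_ge_1)
      qed
    qed
  qed
  also have "\<dots> \<le> ennreal (1 / R) * (\<integral>\<^sup>+\<theta>. ennreal (?Q \<theta>) * indicator (space post) \<theta> \<partial>post)"
    by (rule nn_integral_Markov_inequality) auto
  also have "(\<integral>\<^sup>+\<theta>. ennreal (?Q \<theta>) * indicator (space post) \<theta> \<partial>post) = (\<integral>\<^sup>+\<theta>. ennreal (?Q \<theta>) \<partial>post)"
    by (intro nn_integral_cong) auto
  also have "\<dots> = (\<Sum>i\<le>lh. \<Sum>j<2 ^ i. \<integral>\<^sup>+\<theta>. ennreal ((\<theta> (i, j) - inner_01 f (\<psi> i j))\<^sup>2) \<partial>post)"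
  proof -
    have "(\<integral>\<^sup>+\<theta>. ennreal (?Q \<theta>) \<partial>post)
        = (\<integral>\<^sup>+\<theta>. (\<Sum>i\<le>lh. \<Sum>j<2 ^ i. ennreal ((\<theta> (i, j) - inner_01 f (\<psi> i j))\<^sup>2)) \<partial>post)"
      by (simp add: sum_nonneg)
    also have "\<dots> = (\<Sum>i\<le>lh. \<integral>\<^sup>+\<theta>. (\<Sum>j<2 ^ i. ennreal ((\<theta> (i, j) - inner_01 f (\<psi> i j))\<^sup>2)) \<partial>post)"
      using meas by (intro nn_integral_sum borel_measurable_sum) auto
    also have "\<dots> = (\<Sum>i\<le>lh. \<Sum>j<2 ^ i. \<integral>\<^sup>+\<theta>. ennreal ((\<theta> (i, j) - inner_01 f (\<psi> i j))\<^sup>2) \<partial>post)"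
      using meas by (intro sum.cong refl nn_integral_sum) auto
    finally show ?thesis .
  qed
  also have "\<dots> = (\<Sum>i\<le>lh. \<Sum>j<2 ^ i.
      ennreal (1 / (real n + 1) + (posterior_mean n m y i j - inner_01 f (\<psi> i j))\<^sup>2))"
    by (intro sum.cong refl nn_integral_coeff) auto
  also have "\<dots> = ennreal (\<Sum>i\<le>lh. \<Sum>j<2 ^ i.
      1 / (real n + 1) + (posterior_mean n m y i j - inner_01 f (\<psi> i j))\<^sup>2)"
    by (simp add: sum_nonneg del: ennreal_plus)
  finally show ?thesis
    using R by (simp add: ennreal_mult[symmetric] sum_nonneg)
qed

lemma posterior_prob_le_1: "posterior_prob \<psi> s_min s_max \<tau> n m y A \<le> 1"
  unfolding posterior_prob_def
  using emeasure_space[of post] prob_space.emeasure_space_1[OF prob_space_posterior] by metis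

end

text \<open>With \<open>S\<close> the averaged noise, the error is \<open>n / (n + 1) * S\<close>
  minus the shrinkage bias \<theta> \<open>/ (n + 1)\<close>. The square of a difference costs a
  factor 2 per term, and the shrinkage factors are then bounded by 1 and
  \<open>1 / n\<close>.\<close>

lemma posterior_mean_error_le:
  assumes "m \<ge> 1" "n \<ge> 1"
  shows "(posterior_mean n m (observations \<theta> n m Z) i j - \<theta> i j)\<^sup>2
    \<le> 2 * (\<Sum>k=1..m. sqrt (m / n) / m * Z (k, i, j))\<^sup>2 + 2 * (\<theta> i j)\<^sup>2 / (real n)\<^sup>2"
proof -
  define S where "S = (\<Sum>k=1..m. sqrt (m / n) / m * Z (k, i, j))"
  have "posterior_mean n m (observations \<theta> n m Z) i j
      = n / (m * (real n + 1)) * (m * \<theta> i j + m * S)"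
    using assms by (simp add: posterior_mean_def observations_def sum.distrib sum_distrib_left S_def)
  also have "\<dots> = n / (real n + 1) * (\<theta> i j + S)"
    using assms by (simp add: distrib_left[symmetric])
  finally have "posterior_mean n m (observations \<theta> n m Z) i j - \<theta> i j
      = n / (real n + 1) * (\<theta> i j + S) - \<theta> i j"
    by simp
  also have "\<dots> = n / (real n + 1) * S - \<theta> i j / (real n + 1)"
  proof -
    have "\<theta> i j / (real n + 1) = \<theta> i j - n / (real n + 1) * \<theta> i j"
      by (simp add: field_simps)
    then show ?thesis by (simp add: distrib_left)
  qed
  finally have "posterior_mean n m (observations \<theta> n m Z) i j - \<theta> i j
      = n / (real n + 1) * S - \<theta> i j / (real n + 1)" .
  moreover have "(u - v)\<^sup>2 \<le> 2 * u\<^sup>2 + 2 * v\<^sup>2" for u v :: real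
    using zero_le_power2[of "u + v"] by (simp add: power2_eq_square algebra_simps)
  ultimately have "(posterior_mean n m (observations \<theta> n m Z) i j - \<theta> i j)\<^sup>2
      \<le> 2 * (n / (real n + 1) * S)\<^sup>2 + 2 * (\<theta> i j / (real n + 1))\<^sup>2"
    by simp
  also have "\<dots> = 2 * ((n / (real n + 1))\<^sup>2 * S\<^sup>2) + 2 * ((\<theta> i j)\<^sup>2 / (real n + 1)\<^sup>2)"
    by (simp add: power_mult_distrib power_divide)
  also have "\<dots> \<le> 2 * (1 * S\<^sup>2) + 2 * ((\<theta> i j)\<^sup>2 / (real n)\<^sup>2)"
    using assms
    by (intro add_mono mult_left_mono mult_right_mono divide_left_mono power_mono)
      (auto intro!: power_le_one mult_pos_pos)
  finally show ?thesis by (simp add: S_def)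
qed

text \<open>The averaged noise has variance \<open>m * (m / n) / m ^ 2 = 1 / n\<close>, so each
  coefficient contributes at most \<open>3 / n\<close> plus its shrinkage bias, and there are at
  most \<open>2 * 2 ^ l\<close> coefficients. The level is deterministic here; the random one is
  later bounded by it.\<close>

lemma posterior_mean_risk:
  assumes mn: "m \<ge> 1" "n \<ge> 1"
  shows "(\<integral>\<^sup>+Z. ennreal (\<Sum>i\<le>l. \<Sum>j<2 ^ i.
        1 / (real n + 1) + (posterior_mean n m (observations \<theta> n m Z) i j - \<theta> i j)\<^sup>2) \<partial>noise_law m)
    \<le> ennreal (6 * 2 ^ l / n + 2 * level_energy \<theta> 0 l / (real n)\<^sup>2)"
proof -
  let ?S = "\<lambda>i j Z. \<Sum>k=1..m. sqrt (m / n) / m * Z (k, i, j) :: real"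
  let ?G = "\<lambda>Z. \<Sum>i\<le>l. \<Sum>j<2 ^ i. 1 / n + 2 * (?S i j Z)\<^sup>2 + 2 * (\<theta> i j)\<^sup>2 / (real n)\<^sup>2"
  interpret prob_space "noise_law m" by (rule prob_space_noise_law)
  have S: "integrable (noise_law m) (\<lambda>Z. (?S i j Z)\<^sup>2) \<and> expectation (\<lambda>Z. (?S i j Z)\<^sup>2) = 1 / n"
    if "j < 2 ^ i" for i j
  proof -
    let ?J = "{1..m} \<times> {(i, j)}"
    have J: "finite ?J" "?J \<subseteq> {1..m} \<times> wav_index"
      using that by (auto simp: wav_index_def)
    \<comment> \<open>The linear form is read as a quadratic one with zero quadratic part.\<close>
    have eq: "?S i j Z = (\<Sum>c\<in>?J. sqrt (m / n) / m * Z c + 0 * ((Z c)\<^sup>2 - 1))" for Z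
      by (rule sum.reindex_cong[of "\<lambda>k. (k, i, j)", symmetric]) (auto simp: inj_on_def)
    have "expectation (\<lambda>Z. (?S i j Z)\<^sup>2) = (\<Sum>c\<in>?J. (sqrt (m / n) / m)\<^sup>2 + 2 * 0\<^sup>2)"
      unfolding eq by (rule expectation_square_noise_quadratic(3)[OF J])
    also have "\<dots> = 1 / n"
      using mn by (simp add: power_divide power2_eq_square[of "real m"])
    finally have "expectation (\<lambda>Z. (?S i j Z)\<^sup>2) = 1 / n" .
    moreover have "integrable (noise_law m) (\<lambda>Z. (?S i j Z)\<^sup>2)"
      unfolding eq by (rule expectation_square_noise_quadratic(2)[OF J])
    ultimately show ?thesis by blast
  qed
  have int: "integrable (noise_law m) ?G"
    using S by (intro Bochner_Integration.integrable_sum Bochner_Integration.integrable_add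
        integrable_mult_right integrable_const) auto
  have "(\<integral>\<^sup>+Z. ennreal (\<Sum>i\<le>l. \<Sum>j<2 ^ i.
        1 / (real n + 1) + (posterior_mean n m (observations \<theta> n m Z) i j - \<theta> i j)\<^sup>2) \<partial>noise_law m)
      \<le> (\<integral>\<^sup>+Z. ennreal (?G Z) \<partial>noise_law m)"
  proof (intro nn_integral_mono ennreal_leI sum_mono)
    fix Z i j
    have "1 / (real n + 1) \<le> 1 / real n" using mn by (simp add: field_simps)
    then show "1 / (real n + 1) + (posterior_mean n m (observations \<theta> n m Z) i j - \<theta> i j)\<^sup>2
        \<le> 1 / n + 2 * (?S i j Z)\<^sup>2 + 2 * (\<theta> i j)\<^sup>2 / (real n)\<^sup>2"
      using posterior_mean_error_le[OF mn, of \<theta> Z i j] by linarith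
  qed
  also have "\<dots> = ennreal (expectation ?G)"
    using int by (intro nn_integral_eq_integral) (auto intro!: sum_nonneg)
  also have "expectation ?G = (\<Sum>i\<le>l. \<Sum>j<2 ^ i. 3 / n + 2 * (\<theta> i j)\<^sup>2 / (real n)\<^sup>2)"
  proof -
    have "expectation (\<lambda>Z. 1 / n + 2 * (?S i j Z)\<^sup>2 + 2 * (\<theta> i j)\<^sup>2 / (real n)\<^sup>2)
        = 3 / n + 2 * (\<theta> i j)\<^sup>2 / (real n)\<^sup>2" if "j < 2 ^ i" for i j
      using S[OF that] by (simp add: prob_space)
    moreover have "integrable (noise_law m) (\<lambda>Z. 1 / n + 2 * (?S i j Z)\<^sup>2 + 2 * (\<theta> i j)\<^sup>2 / (real n)\<^sup>2)"
      if "j < 2 ^ i" for i j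
      using S[OF that] by simp
    ultimately show ?thesis
      by (subst Bochner_Integration.integral_sum)
        (auto intro!: sum.cong Bochner_Integration.integrable_sum simp: Bochner_Integration.integral_sum)
  qed
  also have "\<dots> = 3 / n * (\<Sum>i=0..l. 2 ^ i) + 2 * level_energy \<theta> 0 l / (real n)\<^sup>2"
    by (simp add: sum.distrib level_energy_def sum_distrib_left sum_divide_distrib atMost_atLeast0 mult.commute)
  also have "\<dots> \<le> 3 / n * (2 * 2 ^ l) + 2 * level_energy \<theta> 0 l / (real n)\<^sup>2"
    by (intro add_right_mono mult_left_mono sum_two_power_le) simp
  finally show ?thesis by (simp add: ennreal_leI)
qed

section \<open>Localisation of the truncation level\<close>

lemma level_grid_subset_atMost:
  "level_grid s_min s_max n \<subseteq> {..nat \<lfloor>log 2 (real n) / (1 + 2 * s_min)\<rfloor>}"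
  by (auto simp: level_grid_def le_nat_floor)

lemma finite_level_grid: "finite (level_grid s_min s_max n)"
  by (rule finite_subset[OF level_grid_subset_atMost finite_atMost])

text \<open>One admissible level excludes the default value of \<open>l_hat\<close>; as the grid is
  finite, the minimum is attained.\<close>

lemma l_hat_le:
  assumes "l \<in> admissible_levels s_min s_max \<tau> n m y"
  shows "l_hat s_min s_max \<tau> n m y \<le> l"
    and "l_hat s_min s_max \<tau> n m y \<in> admissible_levels s_min s_max \<tau> n m y"
proof -
  have "finite (admissible_levels s_min s_max \<tau> n m y)"
    by (rule finite_subset[OF _ finite_level_grid]) (auto simp: admissible_levels_def)
  then show "l_hat s_min s_max \<tau> n m y \<le> l"
    and "l_hat s_min s_max \<tau> n m y \<in> admissible_levels s_min s_max \<tau> n m y"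
    using assms Min_in by (auto simp: l_hat_def)
qed

lemma level_energy_nonneg: "level_energy \<theta> a b \<ge> 0"
  by (auto simp: level_energy_def intro!: sum_nonneg)

text \<open>The deterministic part of the argument. Small fluctuations above \<open>l0\<close> make
  \<open>l0\<close> admissible, which bounds the selected level. If that level missed too much
  energy below \<open>l0\<close>, only a fluctuation of at least half this energy could let it pass
  its test at \<open>l0\<close>.\<close>

lemma l_hat_localisation:
  fixes \<theta> :: "nat \<Rightarrow> nat \<Rightarrow> real" and l0 :: nat
  assumes n: "n \<ge> 1" and \<tau>: "\<tau> > 2" and l0: "l0 \<in> level_grid s_min s_max n"
    and tail: "\<And>l. level_energy \<theta> l0 l \<le> 2 ^ l0 / n"
    and over: "\<And>l. l \<in> level_grid s_min s_max n \<Longrightarrow> l0 \<le> l \<Longrightarrow> \<bar>fluctuation \<theta> n m l0 l Z\<bar> < 2 ^ l / n"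
    and under: "\<And>l. l \<le> l0 \<Longrightarrow> 2 * \<tau> * 2 ^ l0 / n < level_energy \<theta> l l0 \<Longrightarrow>
      \<bar>fluctuation \<theta> n m l l0 Z\<bar> < level_energy \<theta> l l0 / 2"
  defines "lh \<equiv> l_hat s_min s_max \<tau> n m (observations \<theta> n m Z)"
  shows "lh \<le> l0" and "level_energy \<theta> lh l0 \<le> 2 * \<tau> * 2 ^ l0 / n"
proof -
  have "(\<Sum>i=l0..l. T_tilde n m (observations \<theta> n m Z) i) \<le> \<tau> * 2 ^ l / n"
    if l: "l \<in> level_grid s_min s_max n" "l0 \<le> l" for l
  proof -
    have "(\<Sum>i=l0..l. T_tilde n m (observations \<theta> n m Z) i) \<le> 2 ^ l / n + 2 ^ l0 / n"
      using over[OF l] tail[of l] by (simp add: fluctuation_def)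
    also have "\<dots> \<le> 2 * 2 ^ l / n"
      using l n by (simp add: add_divide_distrib[symmetric] divide_right_mono)
    \<comment> \<open>One unit \<open>2 ^ l / n\<close> pays for the fluctuation and one for the
      remaining signal; this explains the threshold 2 for \<tau>.\<close>
    also have "\<dots> \<le> \<tau> * 2 ^ l / n"
      using \<tau> by (intro divide_right_mono mult_right_mono) auto
    finally show ?thesis .
  qed
  then have "l0 \<in> admissible_levels s_min s_max \<tau> n m (observations \<theta> n m Z)"
    using l0 by (simp add: admissible_levels_def)
  note lh = l_hat_le[OF this, folded lh_def]
  show le: "lh \<le> l0" by (rule lh(1))
  show "level_energy \<theta> lh l0 \<le> 2 * \<tau> * 2 ^ l0 / n"
  proof (rule ccontr)
    assume *: "\<not> level_energy \<theta> lh l0 \<le> 2 * \<tau> * 2 ^ l0 / n"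
    \<comment> \<open>Under the assumption \<open>*\<close> the right-hand side is below half the
      energy, so the fluctuation would lie below minus half the energy.\<close>
    have "(\<Sum>i=lh..l0. T_tilde n m (observations \<theta> n m Z) i) \<le> \<tau> * 2 ^ l0 / n"
      using lh(2) l0 le by (simp add: admissible_levels_def)
    moreover have "\<bar>fluctuation \<theta> n m lh l0 Z\<bar> < level_energy \<theta> lh l0 / 2"
      using under[OF le] * by simp
    moreover have "2 * \<tau> * 2 ^ l0 / n = 2 * (\<tau> * 2 ^ l0 / n)"
      by simp
    ultimately show False using * unfolding fluctuation_def by linarith
  qed
qed

section \<open>Exceptional data and the non-asymptotic bound\<close>

lemma (in finite_measure) measure_UN_le_card:
  fixes c :: real
  assumes "finite I" "\<And>i. i \<in> I \<Longrightarrow> A i \<in> sets M" "\<And>i. i \<in> I \<Longrightarrow> measure M (A i) \<le> c"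
  shows "measure M (\<Union>i\<in>I. A i) \<le> card I * c"
proof -
  have "measure M (\<Union>i\<in>I. A i) \<le> (\<Sum>i\<in>I. measure M (A i))"
    by (rule measure_UNION_le) (use assms in auto)
  also have "\<dots> \<le> (\<Sum>i\<in>I. c)"
    by (rule sum_mono) (rule assms(3))
  finally show ?thesis by simp
qed

text \<open>The first summand is a union bound over exceptional events of probability at most
  \<open>8 * m / 2 ^ l0\<close> each; the second is Markov's inequality at \<open>R\<close> for the
  risk up to \<open>l0\<close>. The bias allowance is \<open>2 * \<tau>\<close> units of
  \<open>2 ^ l0 / n\<close> below \<open>l0\<close> and one above.\<close>

lemma posterior_contraction_bound:
  assumes basis: "orthonormal_basis_01 \<psi>" and f: "f \<in> L2_01"
    and mn: "m \<ge> 1" "n \<ge> 1" and \<tau>: "\<tau> > 2" and l0: "l0 \<in> level_grid s_min s_max n"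
    and tail: "\<And>N. (\<Sum>i=l0..<N. \<Sum>j<2 ^ i. (inner_01 f (\<psi> i j))\<^sup>2) \<le> 2 ^ l0 / n"
    and R: "R > 0" "R + (2 * \<tau> + 1) * 2 ^ l0 / n \<le> R'"
  shows "model_expectation \<psi> n m f (\<lambda>y. posterior_prob \<psi> s_min s_max \<tau> n m y
        {g. R' \<le> (norm_01 (\<lambda>x. g x - f x))\<^sup>2})
    \<le> ennreal ((card (level_grid s_min s_max n) + real l0 + 1) * (8 * real m / 2 ^ l0)
        + (6 * 2 ^ l0 / n + 2 * level_energy (\<lambda>i j. inner_01 f (\<psi> i j)) 0 l0 / (real n)\<^sup>2) / R)"
proof -
  define \<theta> where "\<theta> = (\<lambda>i j. inner_01 f (\<psi> i j))"
  let ?N = "noise_law m" and ?G = "level_grid s_min s_max n" and ?E = "level_energy \<theta>"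
  let ?dev = "\<lambda>a b t. {Z \<in> space ?N. t \<le> \<bar>fluctuation \<theta> n m a b Z\<bar>}"
  let ?I = "{l \<in> ?G. l0 \<le> l}" and ?K = "{l. l \<le> l0 \<and> 2 * \<tau> * 2 ^ l0 / n < ?E l l0}"
  \<comment> \<open>Off \<open>B1\<close> the level \<open>l0\<close> passes all its tests; off
    \<open>B2\<close> no level that misses too much energy below \<open>l0\<close> can pass the test
    at \<open>l0\<close>.\<close>
  define B1 where "B1 = (\<Union>l\<in>?I. ?dev l0 l (2 ^ l / n))"
  define B2 where "B2 = (\<Union>l\<in>?K. ?dev l l0 (?E l l0 / 2))"
  let ?risk = "\<lambda>Z. \<Sum>i\<le>l0. \<Sum>j<2 ^ i.
    1 / (real n + 1) + (posterior_mean n m (observations \<theta> n m Z) i j - \<theta> i j)\<^sup>2"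
  interpret prob_space ?N by (rule prob_space_noise_law)
  have tailE: "?E l0 l \<le> 2 ^ l0 / n" for l
    using tail[of "Suc l"] by (simp add: level_energy_def \<theta>_def atLeastLessThanSuc_atLeastAtMost)
  have fin: "finite ?I" "finite ?K"
    using finite_level_grid by auto
  have p1: "measure ?N (?dev l0 l (2 ^ l / n)) \<le> 8 * real m / 2 ^ l0" and s1: "?dev l0 l (2 ^ l / n) \<in> sets ?N"
    if l: "l \<in> ?I" for l
  proof -
    have t: "(2 ^ l / n :: real) > 0" using mn by simp
    have pw: "(2::real) ^ l0 \<le> 2 ^ l" using l by simp
    have "measure ?N (?dev l0 l (2 ^ l / n)) \<le> (4 * ?E l0 l / n + 4 * 2 ^ l * real m / (real n)\<^sup>2) / (2 ^ l / n)\<^sup>2"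
      by (rule fluctuation_tail(2)[OF mn t])
    \<comment> \<open>The energy is inflated to \<open>2 ^ l * m / n\<close>, so that both variance
      terms coincide and add up to the constant 8.\<close>
    also have "\<dots> \<le> (4 * (2 ^ l * m / n) / n + 4 * 2 ^ l * real m / (real n)\<^sup>2) / (2 ^ l / n)\<^sup>2"
    proof -
      have "?E l0 l \<le> 2 ^ l0 / n" by (rule tailE)
      also have "\<dots> \<le> 2 ^ l * m / n"
        using mn mult_mono[OF pw, of 1 "real m"] by (intro divide_right_mono) auto
      finally show ?thesis
        by (intro divide_right_mono add_right_mono mult_left_mono) auto
    qed
    also have "\<dots> = 8 * real m / 2 ^ l"
      using mn by (simp add: power2_eq_square field_simps)
    also have "\<dots> \<le> 8 * real m / 2 ^ l0"
      using pw by (intro divide_left_mono) auto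
    finally show "measure ?N (?dev l0 l (2 ^ l / n)) \<le> 8 * real m / 2 ^ l0" .
    show "?dev l0 l (2 ^ l / n) \<in> sets ?N" by (rule fluctuation_tail(1)[OF mn t])
  qed
  have p2: "measure ?N (?dev l l0 (?E l l0 / 2)) \<le> 8 * real m / 2 ^ l0" and s2: "?dev l l0 (?E l l0 / 2) \<in> sets ?N"
    if l: "l \<in> ?K" for l
  proof -
    let ?A = "?E l l0"
    \<comment> \<open>Since \<tau> exceeds 2, membership in \<open>?K\<close> gives energy at least
      \<open>4 * 2 ^ l0 / n\<close>, which makes the deviation by half the energy unlikely.\<close>
    have "4 * (2 ^ l0 / n) \<le> 2 * \<tau> * (2 ^ l0 / n)"
      using \<tau> by (intro mult_right_mono) auto
    then have A: "4 * 2 ^ l0 / n \<le> ?A" using l by simp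
    have "0 < 4 * 2 ^ l0 / real n" using mn by simp
    then have A0: "?A > 0" using A by linarith
    then have t: "?A / 2 > 0" by simp
    have "measure ?N (?dev l l0 (?A / 2)) \<le> (4 * ?A / n + 4 * 2 ^ l0 * real m / (real n)\<^sup>2) / (?A / 2)\<^sup>2"
      by (rule fluctuation_tail(2)[OF mn t])
    also have "\<dots> = 16 / (n * ?A) + 16 * 2 ^ l0 * m / (n * ?A)\<^sup>2"
      using A0 mn by (simp add: power2_eq_square field_simps)
    also have "\<dots> \<le> 16 / (4 * 2 ^ l0) + 16 * 2 ^ l0 * m / (4 * 2 ^ l0)\<^sup>2"
    proof -
      have "4 * 2 ^ l0 \<le> n * ?A" using A mn by (simp add: field_simps)
      then show ?thesis
        using A0 mn by (intro add_mono divide_left_mono power_mono mult_pos_pos zero_less_power) auto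
    qed
    also have "\<dots> = (4 + m) / 2 ^ l0"
      by (simp add: power2_eq_square field_simps)
    also have "\<dots> \<le> 8 * real m / 2 ^ l0"
      using mn by (intro divide_right_mono) auto
    finally show "measure ?N (?dev l l0 (?A / 2)) \<le> 8 * real m / 2 ^ l0" .
    show "?dev l l0 (?A / 2) \<in> sets ?N" by (rule fluctuation_tail(1)[OF mn t])
  qed
  have B: "B1 \<in> sets ?N" "B2 \<in> sets ?N"
    unfolding B1_def B2_def using fin s1 s2 by (auto intro!: sets.finite_UN)
  have "measure ?N B1 \<le> card ?I * (8 * real m / 2 ^ l0)"
    unfolding B1_def by (rule measure_UN_le_card[OF fin(1) s1 p1])
  also have "\<dots> \<le> card ?G * (8 * real m / 2 ^ l0)"
    by (intro mult_right_mono of_nat_mono card_mono finite_level_grid) auto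
  finally have P1: "measure ?N B1 \<le> card ?G * (8 * real m / 2 ^ l0)" .
  have "measure ?N B2 \<le> card ?K * (8 * real m / 2 ^ l0)"
    unfolding B2_def by (rule measure_UN_le_card[OF fin(2) s2 p2])
  \<comment> \<open>\<open>?K\<close> is a set of levels in \<open>{0..l0}\<close>.\<close>
  also have "\<dots> \<le> (real l0 + 1) * (8 * real m / 2 ^ l0)"
  proof -
    have "card ?K \<le> card {..l0}" by (intro card_mono) auto
    then show ?thesis by (intro mult_right_mono) auto
  qed
  finally have P2: "measure ?N B2 \<le> (real l0 + 1) * (8 * real m / 2 ^ l0)" .
  \<comment> \<open>Pointwise domination by a measurable function: the trivial bound 1 on
    exceptional data, the Markov bound elsewhere.\<close>
  have bound: "posterior_prob \<psi> s_min s_max \<tau> n m (observations \<theta> n m Z) {g. R' \<le> (norm_01 (\<lambda>x. g x - f x))\<^sup>2}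
      \<le> indicator (B1 \<union> B2) Z + ennreal (1 / R) * ennreal (?risk Z)" (is "?P Z \<le> _")
    if Z: "Z \<in> space ?N" for Z
  proof (cases "Z \<in> B1 \<union> B2")
    case True
    then have "?P Z \<le> indicator (B1 \<union> B2) Z"
      using posterior_prob_le_1 by simp
    then show ?thesis by (rule order_trans) simp
  next
    case False
    let ?lh = "l_hat s_min s_max \<tau> n m (observations \<theta> n m Z)"
    have lh: "?lh \<le> l0" "?E ?lh l0 \<le> 2 * \<tau> * 2 ^ l0 / n"
      by (rule l_hat_localisation[OF mn(2) \<tau> l0 tailE]; use False Z in \<open>force simp: B1_def B2_def not_le\<close>)+
    have "(\<Sum>i\<in>{?lh<..<N}. \<Sum>j<2 ^ i. (\<theta> i j)\<^sup>2) \<le> (2 * \<tau> + 1) * 2 ^ l0 / n" for N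
    proof -
      \<comment> \<open>The two ranges overlap in \<open>l0\<close>; counting a nonnegative term
        twice keeps the upper bound.\<close>
      have "(\<Sum>i\<in>{?lh<..<N}. \<Sum>j<2 ^ i. (\<theta> i j)\<^sup>2) \<le> (\<Sum>i\<in>{?lh..l0} \<union> {l0..<N}. \<Sum>j<2 ^ i. (\<theta> i j)\<^sup>2)"
        by (intro sum_mono2) (auto intro!: sum_nonneg)
      also have "\<dots> \<le> ?E ?lh l0 + (\<Sum>i=l0..<N. \<Sum>j<2 ^ i. (\<theta> i j)\<^sup>2)"
        unfolding level_energy_def by (subst sum.union_inter[symmetric]) (auto intro!: sum_nonneg)
      also have "\<dots> \<le> 2 * \<tau> * 2 ^ l0 / n + 2 ^ l0 / n"
        using lh(2) tail[of N] by (simp add: \<theta>_def)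
      finally show ?thesis by (simp add: add_divide_distrib distrib_right)
    qed
    then have "?P Z \<le> ennreal ((\<Sum>i\<le>?lh. \<Sum>j<2 ^ i.
        1 / (real n + 1) + (posterior_mean n m (observations \<theta> n m Z) i j - inner_01 f (\<psi> i j))\<^sup>2) / R)"
      by (intro posterior_prob_le[OF basis f _ R]) (simp add: \<theta>_def)
    \<comment> \<open>Extending the sum to the fixed level \<open>l0\<close> removes the data-driven
      level from the integrand.\<close>
    also have "\<dots> \<le> ennreal (?risk Z / R)"
      using R lh(1) by (intro ennreal_leI divide_right_mono) (auto simp: \<theta>_def intro!: sum_mono2 sum_nonneg)
    also have "\<dots> = ennreal (1 / R) * ennreal (?risk Z)"
      using R by (subst ennreal_mult[symmetric]) (auto intro!: sum_nonneg)
    finally show ?thesis by (rule order_trans) simp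
  qed
  have [measurable]: "(\<lambda>Z. posterior_mean n m (observations \<theta> n m Z) i j) \<in> borel_measurable ?N"
    if "j < 2 ^ i" for i j
    unfolding posterior_mean_def observations_def using that
    by (intro borel_measurable_times borel_measurable_sum borel_measurable_add measurable_const
        measurable_noise_coordinate) (auto simp: wav_index_def)
  have risk: "(\<lambda>Z. ennreal (?risk Z)) \<in> borel_measurable ?N"
    by (intro measurable_compose[OF _ measurable_ennreal] borel_measurable_sum) measurable
  have "model_expectation \<psi> n m f (\<lambda>y. posterior_prob \<psi> s_min s_max \<tau> n m y
        {g. R' \<le> (norm_01 (\<lambda>x. g x - f x))\<^sup>2}) = (\<integral>\<^sup>+Z. ?P Z \<partial>?N)"
    by (simp add: model_expectation_def \<theta>_def)
  also have "\<dots> \<le> (\<integral>\<^sup>+Z. indicator (B1 \<union> B2) Z + ennreal (1 / R) * ennreal (?risk Z) \<partial>?N)"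
    by (intro nn_integral_mono bound)
  also have "\<dots> = emeasure ?N (B1 \<union> B2) + ennreal (1 / R) * (\<integral>\<^sup>+Z. ennreal (?risk Z) \<partial>?N)"
    using B risk by (subst nn_integral_add) (auto simp: nn_integral_cmult)
  also have "\<dots> \<le> ennreal (card ?G * (8 * real m / 2 ^ l0) + (real l0 + 1) * (8 * real m / 2 ^ l0))
      + ennreal (1 / R) * ennreal (6 * 2 ^ l0 / n + 2 * ?E 0 l0 / (real n)\<^sup>2)"
  proof (intro add_mono mult_left_mono posterior_mean_risk mn)
    have "measure ?N (B1 \<union> B2) \<le> measure ?N B1 + measure ?N B2"
      using B by (rule measure_Un_le)
    then show "emeasure ?N (B1 \<union> B2)
        \<le> ennreal (card ?G * (8 * real m / 2 ^ l0) + (real l0 + 1) * (8 * real m / 2 ^ l0))"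
      unfolding emeasure_eq_measure using P1 P2 by (intro ennreal_leI) linarith
  qed simp
  also have "\<dots> = ennreal ((card ?G + real l0 + 1) * (8 * real m / 2 ^ l0)
      + (6 * 2 ^ l0 / n + 2 * ?E 0 l0 / (real n)\<^sup>2) / R)"
    using R level_energy_nonneg[of \<theta> 0 l0]
    by (simp add: ennreal_mult[symmetric] ennreal_plus[symmetric] distrib_right add_divide_distrib del: ennreal_plus)
  finally show ?thesis by (simp only: \<theta>_def)
qed

section \<open>The oracle level and the rate\<close>

text \<open>With \<open>q = 2 powr (- 2 * s)\<close> the ball bounds the energy of level
  \<open>i\<close> by \<open>L * q ^ i\<close>, and the tail is geometric.\<close>

lemma besov_ball_tail:
  assumes f: "f \<in> besov_ball \<psi> s L" and s: "s > 0" and L: "L > 0"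
  shows "(\<Sum>i=a..<N. \<Sum>j<2 ^ i. (inner_01 f (\<psi> i j))\<^sup>2)
    \<le> L / (1 - 2 powr (- 2 * s)) * 2 powr (- 2 * s * a)"
proof -
  define q where "q = 2 powr (- 2 * s)"
  have q: "0 < q" "q < 1"
    using s by (auto simp: q_def powr_less_one)
  have pw: "2 powr (- 2 * s * real i) = q ^ i" for i :: nat
    using powr_powr[of 2 "- 2 * s" "real i"] powr_realpow[of q i] q by (simp only: q_def)
  have lev: "(\<Sum>j<2 ^ i. (inner_01 f (\<psi> i j))\<^sup>2) \<le> L * q ^ i" for i
  proof -
    have "2 powr (2 * real i * s) * (\<Sum>j<2 ^ i. (inner_01 f (\<psi> i j))\<^sup>2) \<le> L"
      using f by (simp add: besov_ball_def)
    then have "q ^ i * (2 powr (2 * real i * s) * (\<Sum>j<2 ^ i. (inner_01 f (\<psi> i j))\<^sup>2)) \<le> q ^ i * L"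
      using q by (intro mult_left_mono) auto
    moreover have "q ^ i * 2 powr (2 * real i * s) = 1"
      unfolding pw[symmetric] powr_add[symmetric] by (simp add: mult_ac)
    ultimately show ?thesis by (simp only: mult.assoc[symmetric] mult_1_left mult.commute[of L])
  qed
  have geo: "(1 - q) * (\<Sum>i=a..<N. q ^ i) \<le> q ^ a"
  proof (cases "a \<le> N")
    case True
    then have "(1 - q) * (\<Sum>i=a..<N. q ^ i) = q ^ a - q ^ N"
      by (induction N rule: dec_induct) (simp_all add: distrib_left left_diff_distrib[of 1 q "q ^ k" for k])
    then show ?thesis using q by simp
  qed (use q in auto)
  have "(\<Sum>i=a..<N. \<Sum>j<2 ^ i. (inner_01 f (\<psi> i j))\<^sup>2) \<le> L * (\<Sum>i=a..<N. q ^ i)"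
    unfolding sum_distrib_left by (intro sum_mono lev)
  also have "\<dots> \<le> L * (q ^ a / (1 - q))"
    using L q geo by (intro mult_left_mono) (auto simp: pos_le_divide_eq mult.commute)
  also have "\<dots> = L / (1 - q) * 2 powr (- 2 * s * a)"
    by (simp only: pw times_divide_eq_right times_divide_eq_left)
  finally show ?thesis by (simp only: q_def)
qed

text \<open>The real solution \<open>x\<close> of
  \<open>C * 2 powr (- 2 * s * x) = 2 powr x / n\<close> balances bias and variance and satisfies
  \<open>2 powr x = (C * n) powr (1 / (1 + 2 * s))\<close>. Rounding it up costs a factor 2. The
  strict bounds on \<open>s\<close> keep the result inside the grid for large
  \<open>n\<close>.\<close>

lemma exists_oracle_level:
  fixes s_min s_max s C :: real
  assumes s: "0 < s_min" "s_min < s" "s < s_max" and C: "C \<ge> 1"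
  shows "\<forall>\<^sub>F n in sequentially. \<exists>l0 \<in> level_grid s_min s_max n.
    C * 2 powr (- 2 * s * l0) \<le> 2 ^ l0 / n \<and>
    real n powr (1 / (1 + 2 * s)) \<le> 2 ^ l0 \<and>
    2 ^ l0 \<le> 2 * C * real n powr (1 / (1 + 2 * s))"
proof -
  have d: "1 / (1 + 2 * s) < 1 / (1 + 2 * s_min)"
    using s by (intro divide_strict_left_mono) auto
  \<comment> \<open>The larger slope in \<open>log 2 n\<close> absorbs both the constant from
    \<open>C\<close> and the 1 lost by rounding up.\<close>
  have "\<forall>\<^sub>F n in sequentially. log 2 (C * real n) * (1 / (1 + 2 * s)) + 1
      \<le> log 2 (real n) * (1 / (1 + 2 * s_min))"
  proof -
    define \<alpha> \<beta> where "\<alpha> = 1 / (1 + 2 * s)" and "\<beta> = 1 / (1 + 2 * s_min)"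
    have "\<alpha> < \<beta>" "\<alpha> > 0" "C > 0" using d s C by (auto simp: \<alpha>_def \<beta>_def)
    then show ?thesis
      unfolding \<alpha>_def[symmetric] \<beta>_def[symmetric] log_def by real_asymp
  qed
  then show ?thesis
    using eventually_ge_at_top[of 1]
  proof eventually_elim
    case (elim n)
    define x where "x = log 2 (C * real n) / (1 + 2 * s)"
    define l0 where "l0 = nat \<lceil>x\<rceil>"
    have Cn: "C * real n \<ge> 1" "real n \<ge> 1"
      using C elim mult_mono[of 1 C 1 "real n"] by auto
    have x0: "x \<ge> 0" unfolding x_def using s Cn by (intro divide_nonneg_pos) auto
    have l0: "x \<le> l0" "real l0 \<le> x + 1"
      using x0 by (auto simp: l0_def)
    have two_x: "2 powr x = (C * real n) powr (1 / (1 + 2 * s))"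
    proof -
      have "x = log 2 (C * real n) * (1 / (1 + 2 * s))" by (simp add: x_def)
      then have "2 powr x = (2 powr log 2 (C * real n)) powr (1 / (1 + 2 * s))"
        by (simp only: powr_powr)
      then show ?thesis using Cn by simp
    qed
    have lower: "(C * real n) powr (1 / (1 + 2 * s)) \<le> 2 ^ l0"
      unfolding two_x[symmetric] powr_realpow[symmetric, OF zero_less_numeral]
      using l0 by (intro powr_mono) auto
    have "log 2 (real n) / (1 + 2 * s_max) \<le> log 2 (C * real n) / (1 + 2 * s)"
      using s Cn C by (intro frac_le) auto
    then have "l0 \<in> level_grid s_min s_max n"
      using elim l0 by (auto simp: level_grid_def x_def)
    moreover have "C * 2 powr (- 2 * s * l0) \<le> 2 ^ l0 / n"
    proof -
      have "x * (1 + 2 * s) \<le> l0 * (1 + 2 * s)"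
        using l0 s by (intro mult_right_mono) auto
      then have "log 2 (C * real n) \<le> l0 * (1 + 2 * s)"
        using s by (simp add: x_def)
      then have "C * real n \<le> 2 powr (l0 * (1 + 2 * s))"
        using Cn by (simp add: log_le_iff)
      also have "\<dots> = 2 ^ l0 * 2 powr (2 * s * l0)"
        by (simp add: distrib_left powr_add powr_realpow mult_ac)
      finally show ?thesis
        using Cn by (simp add: powr_minus field_simps)
    qed
    moreover have "real n powr (1 / (1 + 2 * s)) \<le> 2 ^ l0"
    proof -
      have "real n powr (1 / (1 + 2 * s)) \<le> (C * real n) powr (1 / (1 + 2 * s))"
        using s Cn C by (intro powr_mono2) (auto simp: mult_le_cancel_right1)
      with lower show ?thesis by simp
    qed
    moreover have "2 ^ l0 \<le> 2 * C * real n powr (1 / (1 + 2 * s))"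
    proof -
      have "(2::real) ^ l0 = 2 powr l0" by (simp add: powr_realpow)
      also have "\<dots> \<le> 2 powr (x + 1)" using l0 by (intro powr_mono) auto
      also have "\<dots> = 2 * (C powr (1 / (1 + 2 * s)) * real n powr (1 / (1 + 2 * s)))"
        using C Cn by (simp add: powr_add two_x powr_mult)
      \<comment> \<open>The exponent is at most 1 and \<open>C \<ge> 1\<close>.\<close>
      also have "\<dots> \<le> 2 * (C powr 1 * real n powr (1 / (1 + 2 * s)))"
        using C s by (intro mult_left_mono mult_right_mono powr_mono) auto
      finally show ?thesis using C by simp
    qed
    ultimately show ?case by blast
  qed
qed

section \<open>Assembly of the contraction rate\<close>

theorem theorem4p3:
  fixes \<psi> :: "nat \<Rightarrow> nat \<Rightarrow> real \<Rightarrow> real"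
    and s_min s_max L \<tau> s :: real
    and m :: "nat \<Rightarrow> nat"
    and M :: "nat \<Rightarrow> real"
  assumes "orthonormal_basis_01 \<psi>"
    and "0 < s_min" and "s_min < s_max"
    and "L > 0" and "\<tau> > 2"
    and "\<And>n. n \<ge> 1 \<Longrightarrow> 1 \<le> m n \<and> real (m n) \<le> real n powr (1 / (1 + 2 * s_max))"
    and "s_min < s" and "s < s_max"
    and "filterlim M at_top sequentially"
  shows "(\<lambda>n. SUP f0 \<in> besov_ball \<psi> s L.
            model_expectation \<psi> n (m n) f0
              (\<lambda>y. posterior_prob \<psi> s_min s_max \<tau> n (m n) y
                 {f. (norm_01 (\<lambda>x. f x - f0 x))\<^sup>2 \<ge> M n * real n powr (- 2 * s / (1 + 2 * s))}))
         \<longlonglongrightarrow> 0"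
proof -
  have s: "s > 0" using assms by simp
  define K where "K = L / (1 - 2 powr (- 2 * s))"
  \<comment> \<open>\<open>K\<close> is the constant of \<open>besov_ball_tail\<close>; the maximum
    supplies \<open>C \<ge> 1\<close> for the oracle level.\<close>
  define C where "C = max 1 K"
  \<comment> \<open>The first summand bounds the probability of exceptional data through the bound
    on \<open>m\<close>. In the second, \<open>24 * C\<close> comes from noise and posterior
    variance, \<open>4 * C\<close> from shrinkage bias.\<close>
  define b where "b = (\<lambda>n. 16 * (log 2 (real n) + 1)
      * (real n powr (1 / (1 + 2 * s_max)) / real n powr (1 / (1 + 2 * s))) + (24 * C + 4 * C) / M n)"
  have "(\<lambda>n. 16 * (log 2 (real n) + 1)
      * (real n powr (1 / (1 + 2 * s_max)) / real n powr (1 / (1 + 2 * s)))) \<longlonglongrightarrow> 0"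
  proof -
    define \<alpha> \<beta> where "\<alpha> = 1 / (1 + 2 * s_max)" and "\<beta> = 1 / (1 + 2 * s)"
    \<comment> \<open>As \<open>s < s_max\<close>, the quotient is a negative power of
      \<open>n\<close>, which beats the logarithm.\<close>
    have "\<alpha> < \<beta>"
      unfolding \<alpha>_def \<beta>_def using assms s by (intro divide_strict_left_mono) auto
    then show ?thesis
      unfolding \<alpha>_def[symmetric] \<beta>_def[symmetric] log_def by real_asymp
  qed
  moreover have "(\<lambda>n. (24 * C + 4 * C) / M n) \<longlonglongrightarrow> 0"
    by (rule tendsto_divide_0[OF tendsto_const filterlim_at_top_imp_at_infinity[OF assms(9)]])
  ultimately have "b \<longlonglongrightarrow> 0"
    unfolding b_def by (rule tendsto_add_zero)
  then have lim: "(\<lambda>n. ennreal (b n)) \<longlonglongrightarrow> 0"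
    using tendsto_ennrealI[of b 0] by simp
  \<comment> \<open>The second bound makes the bias allowance, at most
    \<open>(2 * \<tau> + 1) * 2 * C\<close> times the rate, no more than half the radius.\<close>
  have "\<forall>\<^sub>F n in sequentially. M n \<ge> max 1 (4 * (2 * \<tau> + 1) * C)"
    by (rule assms(9)[unfolded filterlim_at_top, rule_format])
  moreover have "C \<ge> 1" by (simp add: C_def)
  then have "\<forall>\<^sub>F n in sequentially. \<exists>l0 \<in> level_grid s_min s_max n.
      C * 2 powr (- 2 * s * l0) \<le> 2 ^ l0 / n \<and>
      real n powr (1 / (1 + 2 * s)) \<le> 2 ^ l0 \<and>
      2 ^ l0 \<le> 2 * C * real n powr (1 / (1 + 2 * s))"
    using assms s by (intro exists_oracle_level) auto
  ultimately have "\<forall>\<^sub>F n in sequentially. (SUP f0 \<in> besov_ball \<psi> s L.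
            model_expectation \<psi> n (m n) f0
              (\<lambda>y. posterior_prob \<psi> s_min s_max \<tau> n (m n) y
                 {f. (norm_01 (\<lambda>x. f x - f0 x))\<^sup>2 \<ge> M n * real n powr (- 2 * s / (1 + 2 * s))})) \<le> ennreal (b n)"
    using eventually_ge_at_top[of 1]
  proof eventually_elim
    case (elim n)
    then obtain l0 where l0: "l0 \<in> level_grid s_min s_max n"
      and bias: "C * 2 powr (- 2 * s * l0) \<le> 2 ^ l0 / n"
      and lower: "real n powr (1 / (1 + 2 * s)) \<le> 2 ^ l0"
      and upper: "2 ^ l0 \<le> 2 * C * real n powr (1 / (1 + 2 * s))"
      by blast
    have n: "n \<ge> 1" "real n \<ge> 1" and M: "M n \<ge> 1" "4 * (2 * \<tau> + 1) * C \<le> M n"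
      and m: "m n \<ge> 1" "real (m n) \<le> real n powr (1 / (1 + 2 * s_max))"
      using elim assms(6)[of n] by auto
    define \<epsilon> where "\<epsilon> = real n powr (- 2 * s / (1 + 2 * s))"
    have "- 2 * s / (1 + 2 * s) = 1 / (1 + 2 * s) - 1"
      using s by (simp add: field_simps)
    then have eps: "real n powr (1 / (1 + 2 * s)) = n * \<epsilon>"
      using n by (simp add: \<epsilon>_def powr_diff)
    have \<epsilon>0: "\<epsilon> > 0" using n by (simp add: \<epsilon>_def)
    have n_eps: "1 \<le> n * \<epsilon>"
      unfolding eps[symmetric] using n s by (intro ge_one_powr_ge_zero) auto
    have rate: "2 ^ l0 / n \<le> 2 * C * \<epsilon>"
      using upper n unfolding eps by (simp add: field_simps)
    \<comment> \<open>Both counts are logarithmic in \<open>n\<close>, so the union bound has at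
      most \<open>2 * (log 2 n + 1)\<close> events.\<close>
    have grid: "card (level_grid s_min s_max n) \<le> log 2 n + 1" "real l0 \<le> log 2 n"
    proof -
      have *: "log 2 n / (1 + 2 * s_min) \<le> log 2 n / 1"
        using assms n by (intro divide_left_mono) auto
      then show "real l0 \<le> log 2 n" using l0 by (auto simp: level_grid_def)
      let ?k = "nat \<lfloor>log 2 (real n) / (1 + 2 * s_min)\<rfloor>"
      have "card (level_grid s_min s_max n) \<le> card {..?k}"
        by (intro card_mono level_grid_subset_atMost) auto
      moreover have "real ?k \<le> log 2 n / (1 + 2 * s_min)"
        using n assms by (intro of_nat_floor divide_nonneg_pos) auto
      ultimately show "card (level_grid s_min s_max n) \<le> log 2 n + 1"
        using * by simp
    qed
    show ?case
    proof (rule SUP_least)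
      fix f assume f: "f \<in> besov_ball \<psi> s L"
      have K: "K > 0" unfolding K_def using assms s by (auto intro!: divide_pos_pos simp: powr_less_one)
      have tail: "(\<Sum>i=a..<N. \<Sum>j<2 ^ i. (inner_01 f (\<psi> i j))\<^sup>2) \<le> C * 2 powr (- 2 * s * a)" for a N
      proof -
        have "(\<Sum>i=a..<N. \<Sum>j<2 ^ i. (inner_01 f (\<psi> i j))\<^sup>2) \<le> K * 2 powr (- 2 * s * a)"
          unfolding K_def by (rule besov_ball_tail[OF f s]) (rule assms)
        also have "\<dots> \<le> C * 2 powr (- 2 * s * a)"
          by (intro mult_right_mono) (auto simp: C_def)
        finally show ?thesis .
      qed
      let ?E = "level_energy (\<lambda>i j. inner_01 f (\<psi> i j)) 0 l0"
      have E: "?E \<le> C"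
        using tail[of 0 "Suc l0"] by (simp add: level_energy_def atLeastLessThanSuc_atLeastAtMost)
      have "(2 * \<tau> + 1) * 2 ^ l0 / n = (2 * \<tau> + 1) * (2 ^ l0 / n)" by simp
      also have "\<dots> \<le> (2 * \<tau> + 1) * (2 * C * \<epsilon>)"
        using rate assms by (intro mult_left_mono) auto
      also have "\<dots> = (4 * (2 * \<tau> + 1) * C) * \<epsilon> / 2" by simp
      also have "\<dots> \<le> M n * \<epsilon> / 2"
        using M \<epsilon>0 by (intro divide_right_mono mult_right_mono) auto
      \<comment> \<open>The radius is halved between Markov's inequality and the bias.\<close>
      finally have R: "M n * \<epsilon> / 2 + (2 * \<tau> + 1) * 2 ^ l0 / n \<le> M n * \<epsilon>" by linarith
      have "model_expectation \<psi> n (m n) f (\<lambda>y. posterior_prob \<psi> s_min s_max \<tau> n (m n) y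
          {g. M n * \<epsilon> \<le> (norm_01 (\<lambda>x. g x - f x))\<^sup>2})
        \<le> ennreal ((card (level_grid s_min s_max n) + real l0 + 1) * (8 * real (m n) / 2 ^ l0)
          + (6 * 2 ^ l0 / n + 2 * ?E / (real n)\<^sup>2) / (M n * \<epsilon> / 2))"
      proof (rule posterior_contraction_bound)
        show "f \<in> L2_01" using f by (simp add: besov_ball_def)
        show "(\<Sum>i=l0..<N. \<Sum>j<2 ^ i. (inner_01 f (\<psi> i j))\<^sup>2) \<le> 2 ^ l0 / n" for N
          using tail[of l0 N] bias by linarith
      qed (use assms l0 R m n M \<epsilon>0 in auto)
      also have "\<dots> \<le> ennreal (b n)"
      proof (rule ennreal_leI)
        have "(card (level_grid s_min s_max n) + real l0 + 1) * (8 * real (m n) / 2 ^ l0)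
            \<le> (2 * (log 2 n + 1)) * (8 * real n powr (1 / (1 + 2 * s_max)) / real n powr (1 / (1 + 2 * s)))"
          using grid m lower n by (intro mult_mono frac_le) auto
        also have "\<dots> = 16 * (log 2 n + 1) * (real n powr (1 / (1 + 2 * s_max)) / real n powr (1 / (1 + 2 * s)))"
          by simp
        finally have "(card (level_grid s_min s_max n) + real l0 + 1) * (8 * real (m n) / 2 ^ l0) \<le> \<dots>" .
        moreover have "(6 * 2 ^ l0 / n + 2 * ?E / (real n)\<^sup>2) / (M n * \<epsilon> / 2) \<le> (24 * C + 4 * C) / M n"
        proof -
          have "6 * 2 ^ l0 / n \<le> 12 * C * \<epsilon>" using rate by simp
          \<comment> \<open>The shrinkage bias is of smaller order: \<open>n * \<epsilon>\<close> is
            a nonnegative power of \<open>n\<close>, so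
            \<open>n ^ 2 * \<epsilon> \<ge> 1\<close>.\<close>
          moreover have "2 * ?E / (real n)\<^sup>2 \<le> 2 * C * \<epsilon>"
          proof -
            have "1 \<le> (real n)\<^sup>2 * \<epsilon>"
              using mult_mono[OF n(2) n_eps] n by (simp add: power2_eq_square mult_ac)
            then have "2 * ?E * 1 \<le> 2 * C * ((real n)\<^sup>2 * \<epsilon>)"
              using E \<open>C \<ge> 1\<close> level_energy_nonneg by (intro mult_mono) auto
            then show ?thesis using n by (simp add: field_simps)
          qed
          ultimately have "(6 * 2 ^ l0 / n + 2 * ?E / (real n)\<^sup>2) / (M n * \<epsilon> / 2)
              \<le> (12 * C * \<epsilon> + 2 * C * \<epsilon>) / (M n * \<epsilon> / 2)"
            using M \<epsilon>0 by (intro divide_right_mono add_mono) auto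
          also have "\<dots> = (24 * C + 4 * C) / M n"
            using M \<epsilon>0 by (simp add: field_simps)
          finally show ?thesis .
        qed
        ultimately show "(card (level_grid s_min s_max n) + real l0 + 1) * (8 * real (m n) / 2 ^ l0)
            + (6 * 2 ^ l0 / n + 2 * ?E / (real n)\<^sup>2) / (M n * \<epsilon> / 2) \<le> b n"
          unfolding b_def by (intro add_mono)
      qed
      finally show "model_expectation \<psi> n (m n) f (\<lambda>y. posterior_prob \<psi> s_min s_max \<tau> n (m n) y
          {g. M n * real n powr (- 2 * s / (1 + 2 * s)) \<le> (norm_01 (\<lambda>x. g x - f x))\<^sup>2}) \<le> ennreal (b n)"
        by (simp only: \<epsilon>_def)
    qed
  qed
  then show ?thesis
    by (intro tendsto_sandwich[OF _ _ tendsto_const lim]) auto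
qed

end
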